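(* Let $a$ be a positive integer and $b$ an integer with $b>-a$, $ab$ odd, and $\gcd(a,5b)=1$. Then any integer $n$ with $$n\geq 275a(60a^2+b)+\frac{25}2(120a^2+b)\sqrt{2(60a^2+b)}$$ can be written as $$w(aw+b)+\frac{x(ax+b)}2+\frac{y(ay+b)}2+\frac{z(az+b)}2$$ with $w,x,y,z\in\mathbb{N}$.
   Context: $\mathbb{N}=\{0,1,2,\ldots\}$. *)

theory Defs
  imports Complex_Main
begin

end

theory Submission
  imports Defs "HOL-Number_Theory.Number_Theory" "HOL-Computational_Algebra.Squarefree"
    "HOL-Library.Discrete_Functions"
begin

text \<open>
  Writing \<open>A = 2w\<^sup>2 + x\<^sup>2 + y\<^sup>2 + z\<^sup>2\<close> and \<open>B = 2w + x + y + z\<close>, the task is to solve \<open>2n = aA + bB\<close>.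
  As in Cauchy's lemma, \<open>5A - B\<^sup>2\<close> is twice the value of the ternary form
  \<open>2(u\<^sup>2 + v\<^sup>2 + t\<^sup>2) - uv - vt - tu\<close> at the differences \<open>x - w\<close>, \<open>y - w\<close>, \<open>z - w\<close>, and nonnegativity
  of \<open>w, x, y, z\<close> follows from \<open>B\<^sup>2 \<le> 5A\<close> and \<open>4(A - 1) < (B + 1)\<^sup>2\<close>. The lower bound on \<open>n\<close> leaves
  32 consecutive candidates for \<open>B\<close> in its residue class modulo \<open>a\<close>, one of which makes
  \<open>N = (5A - B\<^sup>2)/2\<close> congruent to \<open>5\<close> modulo \<open>8\<close> and to \<open>2\<close> or \<open>3\<close> modulo \<open>5\<close>.

  The ternary form represents every such \<open>N\<close>. One may take \<open>N\<close> squarefree and choose a prime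
  \<open>q \<equiv> 1\<close> modulo \<open>8\<close> with \<open>(q/p) = (-10/p)\<close> for all primes \<open>p\<close> dividing \<open>N\<close>. Then
  \<open>NT\<^sup>2 = 2X\<^sup>2 + 5qW\<^sup>2\<close> is solvable by a box argument and \<open>q\<close> has the form \<open>Y\<^sup>2 + 2Z\<^sup>2\<close>, which gives a
  rational representation of \<open>N\<close>; since the covering radius of the form is less than \<open>1\<close>, the
  descent of Davenport and Cassels makes it integral. The prime \<open>q\<close> comes from a version of
  Dirichlet's theorem involving real characters only.
\<close>

section \<open>Elementary estimates for the von Mangoldt function\<close>

text \<open>Summation by parts: the terms \<open>S (Suc k) * (g k - g (Suc k))\<close> telescope to
  at most \<open>C * (g m - g n)\<close>, and the boundary term \<open>S n * g n\<close> costs at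
  most \<open>C * g n\<close>.\<close>

lemma abel_summation_bound:
  fixes f g :: "nat \<Rightarrow> real"
  assumes part: "\<And>n. \<bar>\<Sum>k\<in>{m..<n}. f k\<bar> \<le> C"
    and anti: "\<And>k. m \<le> k \<Longrightarrow> g (Suc k) \<le> g k" and nonneg: "\<And>k. m \<le> k \<Longrightarrow> 0 \<le> g k"
  shows "\<bar>\<Sum>k\<in>{m..<n}. f k * g k\<bar> \<le> C * g m"
proof -
  define S where "S n = (\<Sum>k\<in>{m..<n}. f k)" for n
  have C: "0 \<le> C" using part[of 0] by linarith
  have "\<bar>(\<Sum>k\<in>{m..<n}. f k * g k) - S n * g n\<bar> \<le> C * (g m - g n)" if "m \<le> n" for n
    using that
  proof (induction n rule: dec_induct)
    case base
    then show ?case by (simp add: S_def)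
  next
    case (step n)
    have *: "(\<Sum>k\<in>{m..<Suc n}. f k * g k) - S (Suc n) * g (Suc n)
        = ((\<Sum>k\<in>{m..<n}. f k * g k) - S n * g n) + S (Suc n) * (g n - g (Suc n))"
      using step.hyps by (simp add: S_def algebra_simps)
    have "\<bar>S (Suc n) * (g n - g (Suc n))\<bar> \<le> C * (g n - g (Suc n))"
      using part[of "Suc n"] anti[OF step.hyps(1)] by (simp add: S_def abs_mult mult_right_mono)
    then show ?case unfolding * using step.IH by (simp add: algebra_simps)
  qed
  moreover have "\<bar>S n * g n\<bar> \<le> C * g n" if "m \<le> n"
    using part[of n] nonneg[OF that] by (simp add: S_def abs_mult mult_right_mono)
  ultimately show ?thesis
    using C nonneg[of m] by (cases "m \<le> n") (force simp: algebra_simps)+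
qed

text \<open>Both sides run over the pairs of positive integers \<open>d\<close>, \<open>m\<close>
  with \<open>d * m <= x\<close>.\<close>

lemma sum_divisors_swap:
  fixes h :: "nat \<Rightarrow> nat \<Rightarrow> 'a::comm_monoid_add"
  shows "(\<Sum>n=1..x. \<Sum>d | d dvd n. h d (n div d)) = (\<Sum>d=1..x. \<Sum>m=1..x div d. h d m)"
proof -
  have "(\<Sum>n=1..x. \<Sum>d | d dvd n. h d (n div d))
      = (\<Sum>(n,d)\<in>Sigma {1..x} (\<lambda>n. {d. d dvd n}). h d (n div d))"
    by (subst sum.Sigma) (auto intro: finite_divisors_nat)
  also have "\<dots> = (\<Sum>(d,m)\<in>Sigma {1..x} (\<lambda>d. {1..x div d}). h d m)"
  proof (rule sum.reindex_bij_witness[of _ "\<lambda>(d,m). (d*m, d)" "\<lambda>(n,d). (d, n div d)"])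
    fix p assume "p \<in> Sigma {1..x} (\<lambda>d. {1..x div d})"
    then obtain d m where p: "p = (d, m)" "1 \<le> d" "1 \<le> m" "m \<le> x div d" by auto
    then have "d * m \<le> x" by (simp add: less_eq_div_iff_mult_less_eq mult.commute)
    then show "(case p of (d,m) \<Rightarrow> (d*m, d)) \<in> Sigma {1..x} (\<lambda>n. {d. d dvd n})"
      using p by auto
  next
    fix p assume "p \<in> Sigma {1..x} (\<lambda>n. {d. d dvd n})"
    then obtain d m where p: "p = (d * m, d)" "1 \<le> d * m" "d * m \<le> x" by (auto elim!: dvdE)
    then have "1 \<le> d" "1 \<le> m" by (auto simp: Suc_le_eq)
    then have "d \<le> d * m" by simp
    then have "d \<le> x" using p(3) by linarith
    moreover have "m \<le> x div d"
      using p(3) \<open>1 \<le> d\<close> by (simp add: less_eq_div_iff_mult_less_eq mult.commute)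
    ultimately show "(case p of (n,d) \<Rightarrow> (d, n div d)) \<in> Sigma {1..x} (\<lambda>d. {1..x div d})"
      using p(1) \<open>1 \<le> d\<close> \<open>1 \<le> m\<close> by auto
  qed auto
  also have "\<dots> = (\<Sum>d=1..x. \<Sum>m=1..x div d. h d m)"
    by (subst sum.Sigma) auto
  finally show ?thesis .
qed

section \<open>Bounds of Chebyshev and Mertens\<close>

definition chebyshev_psi :: "nat \<Rightarrow> real" where
  "chebyshev_psi n = (\<Sum>d=1..n. mangoldt d)"

text \<open>Expand each \<open>ln n\<close> as the sum of \<open>mangoldt\<close> over the divisors
  of \<open>n\<close>; then \<open>d\<close> occurs once for each of its multiples up to
  \<open>x\<close>.\<close>

lemma ln_fact_eq_sum_mangoldt:
  "ln (fact x :: real) = (\<Sum>d=1..x. mangoldt d * real (x div d))"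
proof -
  have "ln (fact x :: real) = (\<Sum>n=1..x. ln (real n))"
    by (induction x) (auto simp: ln_mult simp flip: of_nat_Suc)
  also have "\<dots> = (\<Sum>n=1..x. \<Sum>d | d dvd n. mangoldt d)"
    by (intro sum.cong) (auto simp: mangoldt_sum)
  also have "\<dots> = (\<Sum>d=1..x. \<Sum>m=1..x div d. mangoldt d)"
    by (rule sum_divisors_swap[of "\<lambda>d m. mangoldt d"])
  finally show ?thesis by (simp add: mult.commute)
qed

lemma ln_fact_ge: "ln (fact x :: real) \<ge> real x * ln (real x) - real x"
proof (induction x)
  case (Suc x)
  show ?case
  proof (cases "x = 0")
    case False
    have "ln (1 + 1 / real x) \<le> 1 / real x" by (rule ln_add_one_self_le_self) simp
    moreover have "1 + 1 / real x = real (Suc x) / real x" using False by (simp add: field_simps)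
    ultimately have "ln (real (Suc x)) - ln (real x) \<le> 1 / real x"
      using False by (simp add: ln_div)
    then have "real x * (ln (real (Suc x)) - ln (real x)) \<le> 1"
      using False by (simp add: field_simps)
    moreover have "ln (fact (Suc x) :: real) = ln (real (Suc x)) + ln (fact x)"
      by (simp add: ln_mult del: of_nat_Suc)
    ultimately show ?thesis using Suc.IH by (simp add: algebra_simps)
  qed simp
qed simp

text \<open>The lower half of Mertens' first theorem: bound \<open>x div d\<close> by
  \<open>x / d\<close> in the formula for \<open>ln (fact x)\<close> and divide by \<open>x\<close>.
  It supplies the main term in the search for primes.\<close>

lemma sum_mangoldt_over_id_ge:
  assumes "x > 0"
  shows "(\<Sum>d=1..x. mangoldt d / real d) \<ge> ln (real x) - 1"
proof -
  have "real x * ln (real x) - real x \<le> (\<Sum>d=1..x. mangoldt d * real (x div d))"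
    using ln_fact_ge[of x] by (simp add: ln_fact_eq_sum_mangoldt)
  also have "\<dots> \<le> (\<Sum>d=1..x. mangoldt d * (real x / real d))"
    by (intro sum_mono mult_left_mono mangoldt_nonneg of_nat_div_le_of_nat)
  also have "\<dots> = real x * (\<Sum>d=1..x. mangoldt d / real d)"
    by (simp add: sum_distrib_left algebra_simps)
  finally have "real x * (ln (real x) - 1) \<le> real x * (\<Sum>d=1..x. mangoldt d / real d)"
    by (simp add: algebra_simps)
  then show ?thesis using assms by simp
qed

text \<open>The coefficients \<open>2 * n div d - 2 * (n div d)\<close> are nonnegative and equal 1
  for \<open>n < d <= 2 * n\<close>. Weighted with them, \<open>mangoldt\<close> sums to the
  logarithm of the central binomial coefficient, which is at most
  \<open>2 ^ (2 * n)\<close>.\<close>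

lemma chebyshev_psi_double: "chebyshev_psi (2 * n) - chebyshev_psi n \<le> 2 * real n * ln 2"
proof -
  let ?c = "\<lambda>d. real (2 * n div d) - 2 * real (n div d)"
  have "chebyshev_psi (2 * n) - chebyshev_psi n = (\<Sum>d\<in>{n<..2*n}. mangoldt d)"
  proof -
    have "{1..2*n} = {1..n} \<union> {n<..2*n}" by auto
    moreover have "{1..n} \<inter> {n<..2*n} = {}" by auto
    ultimately have "chebyshev_psi (2 * n) = chebyshev_psi n + (\<Sum>d\<in>{n<..2*n}. mangoldt d)"
      by (simp only: chebyshev_psi_def sum.union_disjoint finite_atLeastAtMost finite_greaterThanAtMost)
    then show ?thesis by simp
  qed
  also have "\<dots> = (\<Sum>d\<in>{n<..2*n}. mangoldt d * ?c d)"
  proof (intro sum.cong refl)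
    fix d assume "d \<in> {n<..2*n}"
    then have "n div d = 0" "2 * n div d = 1" by (auto intro!: div_nat_eqI)
    then show "mangoldt d = mangoldt d * ?c d" by simp
  qed
  also have "\<dots> \<le> (\<Sum>d=1..2*n. mangoldt d * ?c d)"
  proof (intro sum_mono2 mult_nonneg_nonneg mangoldt_nonneg)
    fix d
    have "2 * (n div d) \<le> 2 * n div d"
      by (cases "d = 0") (auto simp: less_eq_div_iff_mult_less_eq mult.assoc)
    then show "0 \<le> ?c d" by (simp add: flip: of_nat_mult)
  qed auto
  also have "\<dots> = (\<Sum>d=1..2*n. mangoldt d * real (2 * n div d))
      - 2 * (\<Sum>d=1..2*n. mangoldt d * real (n div d))"
    by (simp add: algebra_simps sum_subtractf sum_distrib_left)
  also have "(\<Sum>d=1..2*n. mangoldt d * real (n div d)) = (\<Sum>d=1..n. mangoldt d * real (n div d))"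
    by (intro sum.mono_neutral_right) auto
  also have "(\<Sum>d=1..2*n. mangoldt d * real (2 * n div d))
      - 2 * (\<Sum>d=1..n. mangoldt d * real (n div d)) = ln (fact (2 * n)) - 2 * ln (fact n)"
    by (simp add: ln_fact_eq_sum_mangoldt)
  also have "\<dots> = ln (real (2 * n choose n))"
    by (simp add: binomial_fact ln_div ln_mult)
  also have "\<dots> \<le> ln (2 ^ (2 * n))"
  proof -
    have "(2 * n choose n) \<le> (\<Sum>k\<le>2*n. 2 * n choose k)"
      by (rule member_le_sum) auto
    then have "(2 * n choose n) \<le> 2 ^ (2 * n)" by (simp only: choose_row_sum)
    then have "real (2 * n choose n) \<le> 2 ^ (2 * n)" by (metis of_nat_le_iff of_nat_numeral of_nat_power)
    then show ?thesis by (simp add: zero_less_binomial)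
  qed
  finally show ?thesis by (simp add: ln_realpow)
qed

lemma chebyshev_psi_mono: "m \<le> n \<Longrightarrow> chebyshev_psi m \<le> chebyshev_psi n"
  unfolding chebyshev_psi_def by (intro sum_mono2) (auto simp: mangoldt_nonneg)

lemma chebyshev_psi_le: "chebyshev_psi n \<le> 4 * real n"
proof (induction n rule: less_induct)
  case (less n)
  show ?case
  proof (cases "n \<le> 1")
    case True
    then have "n = 0 \<or> n = 1" by auto
    then show ?thesis by (auto simp: chebyshev_psi_def)
  next
    case False
    \<comment> \<open>Half of \<open>n\<close> rounded up. Doubling gives the bound
      \<open>4 * m + 2 * m\<close>, hence at most \<open>3 * n + 3\<close>, which suffices for
      \<open>n >= 3\<close>; for \<open>n = 2\<close> one has \<open>m = 1\<close>.\<close>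
    define m where "m = (n + 1) div 2"
    have m: "m < n" "n \<le> 2 * m" "2 * m \<le> n + 1" "1 \<le> m"
      using False by (auto simp: m_def)
    have "real m * ln 2 \<le> real m"
      using ln_2_less_1 by (simp add: mult_left_le)
    moreover have "real m * 2 \<le> real n + 1" using m(3) by linarith
    moreover have "n = 2 \<Longrightarrow> m = 1" by (simp add: m_def)
    moreover have "n = 2 \<or> real n \<ge> 3" using False by linarith
    ultimately show ?thesis
      using chebyshev_psi_mono[OF m(2)] chebyshev_psi_double[of m] less.IH[OF m(1)]
      by (auto simp: chebyshev_psi_def)
  qed
qed

section \<open>Real characters\<close>

text \<open>The bound on sums over intervals stands in for periodicity and orthogonality: it
  excludes principal characters and makes the series at 1 converge.\<close>

locale real_character =
  fixes \<chi> :: "nat \<Rightarrow> real" and C :: real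
  assumes mult: "\<chi> (m * n) = \<chi> m * \<chi> n"
    and one: "\<chi> 1 = 1"
    and vals: "\<chi> n \<in> {-1, 0, 1}"
    and sum_bounded: "\<bar>\<Sum>k\<in>{m..<n}. \<chi> k\<bar> \<le> C"
begin

lemma abs_le_1: "\<bar>\<chi> n\<bar> \<le> 1"
  using vals[of n] by auto

lemma C_nonneg: "0 \<le> C"
  using sum_bounded[of 0 0] by simp

lemma power: "\<chi> (p ^ k) = \<chi> p ^ k"
  by (induction k) (use one in \<open>auto simp: mult\<close>)

lemma sum_mult_antimono_bound:
  assumes "\<And>k. m \<le> k \<Longrightarrow> g (Suc k) \<le> g k" and "\<And>k. m \<le> k \<Longrightarrow> 0 \<le> g k"
  shows "\<bar>\<Sum>k\<in>{m..<n}. \<chi> k * g k\<bar> \<le> C * g m"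
  using assms by (rule abel_summation_bound[OF sum_bounded])

definition L :: real where "L = lim (\<lambda>n. \<Sum>k=1..n. \<chi> k / real k)"

lemma sum_over_id_diff_le:
  assumes "m \<le> n"
  shows "\<bar>(\<Sum>k=1..n. \<chi> k / real k) - (\<Sum>k=1..m. \<chi> k / real k)\<bar> \<le> C / real (Suc m)"
proof -
  have "{1..n} = {1..m} \<union> {Suc m..<Suc n}" "{1..m} \<inter> {Suc m..<Suc n} = {}" using assms by auto
  then have "(\<Sum>k=1..n. \<chi> k / real k) = (\<Sum>k=1..m. \<chi> k / real k) + (\<Sum>k\<in>{Suc m..<Suc n}. \<chi> k / real k)"
    by (simp only: sum.union_disjoint finite_atLeastAtMost finite_atLeastLessThan)
  moreover have "\<bar>\<Sum>k\<in>{Suc m..<Suc n}. \<chi> k * (1 / real k)\<bar> \<le> C * (1 / real (Suc m))"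
    by (rule sum_mult_antimono_bound) (auto simp: field_simps)
  ultimately show ?thesis by simp
qed

lemma tendsto_L: "(\<lambda>n. \<Sum>k=1..n. \<chi> k / real k) \<longlonglongrightarrow> L"
proof -
  have "Cauchy (\<lambda>n. \<Sum>k=1..n. \<chi> k / real k)"
  proof (rule CauchyI)
    fix e :: real assume "0 < e"
    obtain M :: nat where M: "C / e < real M" using reals_Archimedean2 by blast
    have bd: "\<bar>(\<Sum>k=1..n. \<chi> k / real k) - (\<Sum>k=1..m. \<chi> k / real k)\<bar> < e" if "M \<le> m" "m \<le> n" for m n
    proof -
      have "C < e * real (Suc m)" using M \<open>0 < e\<close> that(1)
        by (smt (verit) mult.commute mult_less_cancel_left_pos of_nat_Suc of_nat_le_iff pos_divide_less_eq)
      then have "C / real (Suc m) < e" by (simp add: field_simps)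
      then show ?thesis using sum_over_id_diff_le[OF that(2)] by linarith
    qed
    show "\<exists>M. \<forall>m\<ge>M. \<forall>n\<ge>M. norm ((\<Sum>k=1..m. \<chi> k / real k) - (\<Sum>k=1..n. \<chi> k / real k)) < e"
    proof (intro exI allI impI)
      fix m n assume "M \<le> m" "M \<le> n"
      then show "norm ((\<Sum>k=1..m. \<chi> k / real k) - (\<Sum>k=1..n. \<chi> k / real k)) < e"
        using bd[of m n] bd[of n m] by (cases "m \<le> n") (auto simp: abs_minus_commute)
    qed
  qed
  then show ?thesis unfolding L_def
    by (metis Cauchy_convergent convergent_LIMSEQ_iff)
qed

lemma L_approx: "\<bar>L - (\<Sum>k=1..m. \<chi> k / real k)\<bar> \<le> C / real (Suc m)"
proof (rule LIMSEQ_le_const2)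
  show "(\<lambda>n. \<bar>(\<Sum>k=1..n. \<chi> k / real k) - (\<Sum>k=1..m. \<chi> k / real k)\<bar>)
      \<longlonglongrightarrow> \<bar>L - (\<Sum>k=1..m. \<chi> k / real k)\<bar>"
    by (intro tendsto_intros tendsto_L)
  show "\<exists>N. \<forall>n\<ge>N. \<bar>(\<Sum>k=1..n. \<chi> k / real k) - (\<Sum>k=1..m. \<chi> k / real k)\<bar> \<le> C / real (Suc m)"
    using sum_over_id_diff_le by blast
qed

text \<open>The Dirichlet convolution of \<open>\<chi>\<close> with the constant 1, that is, the
  coefficients of the zeta function times the L-series.\<close>

definition divisor_sum :: "nat \<Rightarrow> real" where
  "divisor_sum n = (\<Sum>d | d dvd n. \<chi> d)"

text \<open>A divisor of \<open>p ^ k * m\<close> is uniquely \<open>p ^ i * e\<close> with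
  \<open>i <= k\<close> and \<open>e\<close> dividing \<open>m\<close>; the multiplicity of
  \<open>p\<close> recovers \<open>i\<close>.\<close>

lemma divisor_sum_prime_power_mult:
  assumes "prime p" "\<not> p dvd m" "m > 0"
  shows "divisor_sum (p ^ k * m) = (\<Sum>i\<le>k. \<chi> p ^ i) * divisor_sum m"
proof -
  have "bij_betw (\<lambda>x. p ^ fst x * snd x) ({..k} \<times> {e. e dvd m}) {d. d dvd p ^ k * m}"
  proof -
    have "inj_on (\<lambda>x. p ^ fst x * snd x) ({..k} \<times> {e. e dvd m})"
    proof (rule inj_onI, clarsimp)
      fix i e i' e' assume *: "e dvd m" "e' dvd m" "p ^ i * e = p ^ i' * e'"
      have "multiplicity p (p ^ i * e) = i" if "e dvd m" for i e
        using assms that by (intro multiplicity_eqI) (auto dest: dvd_trans simp: prime_gt_0_nat)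
      then have "i = i'" using * by metis
      then show "i = i' \<and> e = e'" using * assms by (auto simp: prime_gt_0_nat)
    qed
    moreover have "(\<lambda>x. p ^ fst x * snd x) ` ({..k} \<times> {e. e dvd m}) = {d. d dvd p ^ k * m}"
    proof (intro equalityI subsetI)
      fix d assume "d \<in> {d. d dvd p ^ k * m}"
      then obtain b c where bc: "d = b * c" "b dvd p ^ k" "c dvd m"
        using division_decomp by blast
      then obtain i where "i \<le> k" "b = p ^ i" using assms(1) divides_primepow_nat by blast
      then show "d \<in> (\<lambda>x. p ^ fst x * snd x) ` ({..k} \<times> {e. e dvd m})"
        using bc by force
    qed (auto intro!: mult_dvd_mono le_imp_power_dvd)
    ultimately show ?thesis by (simp add: bij_betw_def)
  qed
  then have "divisor_sum (p ^ k * m) = (\<Sum>x\<in>{..k} \<times> {e. e dvd m}. \<chi> (p ^ fst x * snd x))"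
    unfolding divisor_sum_def by (rule sum.reindex_bij_betw[symmetric])
  also have "\<dots> = (\<Sum>i\<le>k. \<chi> p ^ i) * divisor_sum m"
    by (simp add: divisor_sum_def sum_product sum.cartesian_product mult power case_prod_beta)
  finally show ?thesis .
qed

lemma geometric_sum_nonneg: "0 \<le> (\<Sum>i\<le>k. \<chi> p ^ i)"
proof -
  have "(\<Sum>i\<le>k. (-1) ^ i :: real) = (if even k then 1 else 0)" by (induction k) auto
  then have "(\<Sum>i\<le>k. (-1) ^ i :: real) \<ge> 0" by simp
  moreover have "(\<Sum>i\<le>k. 0 ^ i :: real) \<ge> 0" by (intro sum_nonneg) auto
  ultimately show ?thesis using vals[of p] by auto
qed

lemma divisor_sum_nonneg: "n > 0 \<Longrightarrow> 0 \<le> divisor_sum n"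
proof (induction n rule: less_induct)
  case (less n)
  show ?case
  proof (cases "n = 1")
    case True
    then show ?thesis using one by (simp add: divisor_sum_def)
  next
    case False
    then obtain p where p: "prime p" "p dvd n" using prime_factor_nat by blast
    then obtain m where m: "n = p ^ multiplicity p n * m" "\<not> p dvd m"
      using less.prems multiplicity_decompose'[of n p] by (metis not_prime_unit not_gr_zero)
    have "multiplicity p n > 0" using p less.prems by (simp add: prime_multiplicity_gt_zero_iff)
    then have "p ^ multiplicity p n > 1" using prime_gt_1_nat[OF p(1)] by (intro one_less_power) auto
    moreover have "m > 0" using m less.prems by (metis gr_zeroI mult_0_right)
    ultimately have "1 * m < p ^ multiplicity p n * m" by (intro mult_strict_right_mono) auto
    then have "m < n" using m(1) by simp
    then show ?thesis
      using divisor_sum_prime_power_mult[OF p(1) m(2) \<open>m > 0\<close>, of "multiplicity p n"]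
        geometric_sum_nonneg less.IH[of m] \<open>m > 0\<close> m(1) by simp
  qed
qed

text \<open>The exponent of 2 is even, so the geometric sum is at least 1 for each possible value of
  \<open>\<chi> 2\<close>. Together with nonnegativity this makes the partial sums of
  \<open>divisor_sum\<close> unbounded.\<close>

lemma divisor_sum_4_power: "1 \<le> divisor_sum (4 ^ k)"
proof -
  have "(4::nat) ^ k = 2 ^ (2 * k) * 1" by (simp add: power_mult)
  then have "divisor_sum (4 ^ k) = (\<Sum>i\<le>2*k. \<chi> 2 ^ i)"
    using divisor_sum_prime_power_mult[of 2 1 "2 * k"] one by (simp add: divisor_sum_def)
  moreover have "(\<Sum>i\<le>2*k. (-1) ^ i :: real) = 1" by (induction k) auto
  moreover have "(\<Sum>i\<le>2*k. 0 ^ i :: real) = 1" by (induction k) auto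
  ultimately show ?thesis using vals[of 2] by auto
qed

end

text \<open>Monsky's argument for \<open>L \<noteq> 0\<close>: if \<open>L = 0\<close>, the Lambert series of \<open>\<chi>\<close> can be rewritten with
  the following coefficients, whose monotonicity bounds it as \<open>x\<close> tends to \<open>1\<close>.\<close>

definition lambert_defect :: "real \<Rightarrow> nat \<Rightarrow> real" where
  "lambert_defect x n = 1 / (real n * (1 - x)) - x ^ n / (1 - x ^ n)"

text \<open>The inequality of arithmetic and geometric means for the terms \<open>i\<close> and
  \<open>n - 1 - i\<close>. Working with \<open>r^2\<close> in place of \<open>x\<close> turns the
  half-integral middle power of \<open>x\<close> into a power of \<open>r\<close>.\<close>

lemma geometric_sum_ge:
  fixes r :: real
  assumes "0 \<le> r"
  shows "(\<Sum>i<n. (r\<^sup>2) ^ i) \<ge> real n * r ^ (n - 1)"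
proof -
  have "2 * (\<Sum>i<n. (r\<^sup>2) ^ i) = (\<Sum>i<n. (r\<^sup>2) ^ i) + (\<Sum>i<n. (r\<^sup>2) ^ (n - Suc i))"
    by (simp add: sum.nat_diff_reindex)
  also have "\<dots> = (\<Sum>i<n. (r ^ i)\<^sup>2 + (r ^ (n - Suc i))\<^sup>2)"
    by (simp add: sum.distrib mult.commute flip: power_mult)
  also have "\<dots> \<ge> (\<Sum>i<n. 2 * r ^ (n - 1))"
  proof (rule sum_mono)
    fix i assume "i \<in> {..<n}"
    then have "i + (n - Suc i) = n - 1" by auto
    then have "r ^ i * r ^ (n - Suc i) = r ^ (n - 1)" by (metis power_add)
    then show "2 * r ^ (n - 1) \<le> (r ^ i)\<^sup>2 + (r ^ (n - Suc i))\<^sup>2"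
      using sum_squares_bound[of "r ^ i" "r ^ (n - Suc i)"] by (simp add: mult.assoc)
  qed
  finally show ?thesis by simp
qed

lemma lambert_defect_eq:
  assumes "0 \<le> x" "x < 1" "n > 0"
  shows "lambert_defect x n = (1 / real n - x ^ n / (\<Sum>i<n. x ^ i)) / (1 - x)"
proof -
  have "x ^ n < 1" using assms by (simp add: power_less_one_iff)
  moreover have "(1 - x) * (\<Sum>i<n. x ^ i) = 1 - x ^ n" by (simp add: one_diff_power_eq)
  ultimately show ?thesis using assms unfolding lambert_defect_def
    by (simp add: diff_divide_distrib mult.commute flip: \<open>(1 - x) * (\<Sum>i<n. x ^ i) = 1 - x ^ n\<close>)
qed

text \<open>Without the common factor \<open>1 / (1 - x)\<close> the claim reads
  \<open>x^n / (S n * S (n + 1)) <= 1 / (n * (n + 1))\<close>. The lower bounds for the two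
  geometric sums multiply to \<open>n * (n + 1) * r^(2 * n - 1)\<close>, and this is at least
  \<open>n * (n + 1) * x^n\<close>.\<close>

lemma lambert_defect_antimono:
  assumes "0 < r" "r < 1" "n > 0"
  shows "lambert_defect (r\<^sup>2) (Suc n) \<le> lambert_defect (r\<^sup>2) n"
proof -
  define x where "x = r\<^sup>2"
  define S where "S n = (\<Sum>i<n. x ^ i)" for n
  have x: "0 < x" "x < 1" using assms by (auto simp: x_def power_less_one_iff)
  have Sn: "S n \<ge> real n * r ^ (n - 1)" for n using geometric_sum_ge[of r n] assms by (simp add: S_def x_def)
  have pos: "S n > 0" if "n > 0" for n
    using Sn[of n] that assms by (smt (verit) mult_pos_pos of_nat_0_less_iff zero_less_power)
  have "real n * real (Suc n) * x ^ n \<le> real n * real (Suc n) * r ^ (2 * n - 1)"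
    using assms by (intro mult_left_mono) (auto simp: x_def simp flip: power_mult intro!: power_decreasing)
  also have "\<dots> = (real n * r ^ (n - 1)) * (real (Suc n) * r ^ n)"
    using assms by (simp add: mult_2 flip: power_add)
  also have "\<dots> \<le> S n * S (Suc n)"
    using Sn[of n] Sn[of "Suc n"] assms pos[of n] by (intro mult_mono) auto
  finally have *: "real n * real (Suc n) * x ^ n \<le> S n * S (Suc n)" .
  have "x ^ n / S n - x ^ Suc n / S (Suc n) = x ^ n * (S (Suc n) - x * S n) / (S n * S (Suc n))"
    using pos[of n] pos[of "Suc n"] assms(3) by (simp add: field_simps)
  also have "S (Suc n) - x * S n = 1"
    unfolding S_def by (subst sum.lessThan_Suc_shift) (simp add: sum_distrib_left)
  also have "x ^ n * 1 / (S n * S (Suc n)) \<le> 1 / (real n * real (Suc n))"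
  proof -
    have "y * 1 / P \<le> 1 / Q" if "Q * y \<le> P" "0 < P" "0 < Q" for P Q y :: real
      using that by (simp add: field_simps)
    from this[OF *] show ?thesis using pos[of n] pos[of "Suc n"] assms(3) by simp
  qed
  also have "\<dots> = 1 / real n - 1 / real (Suc n)" using assms(3) by (simp add: field_simps)
  finally have "1 / real (Suc n) - x ^ Suc n / S (Suc n) \<le> 1 / real n - x ^ n / S n" by simp
  then have "(1 / real (Suc n) - x ^ Suc n / S (Suc n)) / (1 - x) \<le> (1 / real n - x ^ n / S n) / (1 - x)"
    using x by (intro divide_right_mono) auto
  then show ?thesis
    using x assms(3) lambert_defect_eq[of x n] lambert_defect_eq[of x "Suc n"] by (simp add: S_def x_def)
qed

lemma lambert_defect_nonneg:
  assumes "0 < x" "x < 1" "n > 0"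
  shows "0 \<le> lambert_defect x n"
proof -
  have le: "(\<Sum>i<n. x ^ n) \<le> (\<Sum>i<n. x ^ i)"
    using assms by (intro sum_mono power_decreasing) auto
  have "0 < (\<Sum>i<n. x ^ n)" using assms by simp
  with le have "0 < (\<Sum>i<n. x ^ i)" by linarith
  with le have "x ^ n / (\<Sum>i<n. x ^ i) \<le> 1 / real n"
    using assms by (simp add: field_simps)
  then show ?thesis using assms by (simp add: lambert_defect_eq)
qed

context real_character
begin

text \<open>Write \<open>x^d / (1 - x^d)\<close> as \<open>1 / (d * (1 - x))\<close> minus the
  defect. The defects decrease from the value 1 at \<open>d = 1\<close>, so by partial summation
  they contribute at most \<open>C\<close>, uniformly in \<open>x\<close>.\<close>

lemma abs_lambert_sum_le:
  assumes "0 < r" "r < 1"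
  defines "x \<equiv> r\<^sup>2"
  shows "\<bar>\<Sum>d=1..K. \<chi> d * (x ^ d / (1 - x ^ d))\<bar> \<le> \<bar>\<Sum>d=1..K. \<chi> d / real d\<bar> / (1 - x) + C"
proof -
  have x: "0 < x" "x < 1" using assms by (auto simp: x_def power_less_one_iff)
  have "(\<Sum>d=1..K. \<chi> d * (x ^ d / (1 - x ^ d)))
      = (\<Sum>d=1..K. \<chi> d / real d) / (1 - x) - (\<Sum>d\<in>{1..<Suc K}. \<chi> d * lambert_defect x d)"
    by (simp add: lambert_defect_def sum_subtractf sum_divide_distrib algebra_simps
        atLeastLessThanSuc_atLeastAtMost del: One_nat_def)
  moreover have "\<bar>\<Sum>d\<in>{1..<Suc K}. \<chi> d * lambert_defect x d\<bar> \<le> C"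
  proof -
    have "\<bar>\<Sum>d\<in>{1..<Suc K}. \<chi> d * lambert_defect x d\<bar> \<le> C * lambert_defect x 1"
      by (rule sum_mult_antimono_bound) (use assms lambert_defect_antimono lambert_defect_nonneg x in \<open>auto simp: x_def\<close>)
    moreover have "lambert_defect x 1 = 1"
      using x by (simp add: lambert_defect_def field_simps)
    ultimately show ?thesis by (simp only: mult_1_right)
  qed
  moreover have "\<bar>(\<Sum>d=1..K. \<chi> d / real d) / (1 - x)\<bar> = \<bar>\<Sum>d=1..K. \<chi> d / real d\<bar> / (1 - x)"
    using x by simp
  ultimately show ?thesis by linarith
qed

text \<open>Grouping by \<open>d\<close> gives geometric sums cut off at \<open>K div d\<close>.
  Completing them yields the Lambert series, and each of the \<open>K\<close> tails is at most
  \<open>x^K / (1 - x)\<close> because \<open>d * Suc (K div d) >= K\<close>.\<close>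

lemma sum_divisor_sum_power_le:
  assumes "0 < r" "r < 1"
  defines "x \<equiv> r\<^sup>2"
  shows "(\<Sum>n=1..K. divisor_sum n * x ^ n)
    \<le> \<bar>\<Sum>d=1..K. \<chi> d / real d\<bar> / (1 - x) + C + real K * x ^ K / (1 - x)"
proof -
  have x: "0 < x" "x < 1" using assms by (auto simp: x_def power_less_one_iff)
  have "(\<Sum>n=1..K. divisor_sum n * x ^ n) = (\<Sum>n=1..K. \<Sum>d | d dvd n. \<chi> d * x ^ (d * (n div d)))"
    unfolding divisor_sum_def sum_distrib_right by (intro sum.cong) auto
  also have "\<dots> = (\<Sum>d=1..K. \<Sum>m=1..K div d. \<chi> d * x ^ (d * m))"
    by (rule sum_divisors_swap)
  also have "\<dots> = (\<Sum>d=1..K. \<chi> d * (x ^ d / (1 - x ^ d)) - \<chi> d * (x ^ (d * Suc (K div d)) / (1 - x ^ d)))"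
  proof (intro sum.cong refl)
    fix d assume "d \<in> {1..K}"
    then have "x ^ d < 1" using x by (simp add: power_less_one_iff)
    have "(\<Sum>m=1..K div d. (x ^ d) ^ m) = (x ^ d - x ^ (d * Suc (K div d))) / (1 - x ^ d)"
      using \<open>x ^ d < 1\<close> x by (subst sum_gp) (auto simp: power_mult power_add div_eq_0_iff)
    then show "(\<Sum>m=1..K div d. \<chi> d * x ^ (d * m))
        = \<chi> d * (x ^ d / (1 - x ^ d)) - \<chi> d * (x ^ (d * Suc (K div d)) / (1 - x ^ d))"
      by (simp add: sum_distrib_left[symmetric] power_mult diff_divide_distrib right_diff_distrib)
  qed
  also have "\<dots> = (\<Sum>d=1..K. \<chi> d * (x ^ d / (1 - x ^ d))) - (\<Sum>d=1..K. \<chi> d * (x ^ (d * Suc (K div d)) / (1 - x ^ d)))"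
    by (rule sum_subtractf)
  finally have eq: "(\<Sum>n=1..K. divisor_sum n * x ^ n) = \<dots>" .
  have "\<bar>\<Sum>d=1..K. \<chi> d * (x ^ (d * Suc (K div d)) / (1 - x ^ d))\<bar> \<le> (\<Sum>d=1..K. x ^ K / (1 - x))"
  proof (rule order_trans[OF sum_abs sum_mono])
    fix d assume d: "d \<in> {1..K}"
    have "d * Suc (K div d) \<ge> K" using d dividend_less_times_div[of d K] by simp
    then have "x ^ (d * Suc (K div d)) \<le> x ^ K" using x by (intro power_decreasing) auto
    moreover have "x ^ d \<le> x" using d x power_decreasing[of 1 d x] by simp
    ultimately have "x ^ (d * Suc (K div d)) / (1 - x ^ d) \<le> x ^ K / (1 - x)"
      using x by (intro frac_le) auto
    moreover have "0 \<le> x ^ (d * Suc (K div d)) / (1 - x ^ d)"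
      using x \<open>x ^ d \<le> x\<close> by (intro divide_nonneg_nonneg) auto
    ultimately show "\<bar>\<chi> d * (x ^ (d * Suc (K div d)) / (1 - x ^ d))\<bar> \<le> x ^ K / (1 - x)"
      using abs_le_1[of d] unfolding abs_mult
      by (smt (verit) mult_left_le_one_le abs_ge_zero abs_of_nonneg)
  qed
  then show ?thesis using eq abs_lambert_sum_le[OF assms(1,2), of K] by (simp add: x_def)
qed

text \<open>If \<open>L = 0\<close>, letting \<open>K\<close> tend to infinity and then
  \<open>x\<close> to 1 bounds every partial sum of \<open>divisor_sum\<close> by \<open>C\<close>,
  while each power of 4 contributes at least 1.\<close>

theorem L_nonzero: "L \<noteq> 0"
proof
  assume "L = 0"
  have bound: "(\<Sum>n=1..M. divisor_sum n * x ^ n) \<le> C" if "0 < x" "x < 1" for x M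
  proof (rule LIMSEQ_le_const)
    define r where "r = sqrt x"
    have r: "0 < r" "r < 1" "r\<^sup>2 = x" using that by (auto simp: r_def)
    show "(\<lambda>K. \<bar>\<Sum>d=1..K. \<chi> d / real d\<bar> / (1 - x) + C + real K * x ^ K / (1 - x)) \<longlonglongrightarrow> C"
    proof -
      have "(\<lambda>K. \<bar>\<Sum>d=1..K. \<chi> d / real d\<bar> / (1 - x) + C + real K * x ^ K / (1 - x))
          \<longlonglongrightarrow> \<bar>0\<bar> / (1 - x) + C + 0 / (1 - x)"
        using tendsto_L that powser_times_n_limit_0[of x] unfolding \<open>L = 0\<close>
        by (intro tendsto_intros) auto
      then show ?thesis by simp
    qed
    show "\<exists>N. \<forall>K\<ge>N. (\<Sum>n=1..M. divisor_sum n * x ^ n)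
        \<le> \<bar>\<Sum>d=1..K. \<chi> d / real d\<bar> / (1 - x) + C + real K * x ^ K / (1 - x)"
    proof (intro exI allI impI)
      fix K assume "M \<le> K"
      then have "(\<Sum>n=1..M. divisor_sum n * x ^ n) \<le> (\<Sum>n=1..K. divisor_sum n * x ^ n)"
        using that by (intro sum_mono2) (auto intro!: mult_nonneg_nonneg divisor_sum_nonneg)
      then show "(\<Sum>n=1..M. divisor_sum n * x ^ n)
          \<le> \<bar>\<Sum>d=1..K. \<chi> d / real d\<bar> / (1 - x) + C + real K * x ^ K / (1 - x)"
        using sum_divisor_sum_power_le[OF r(1,2), of K] r(3) by simp
    qed
  qed
  have bound1: "(\<Sum>n=1..M. divisor_sum n) \<le> C" for M
  proof (rule tendsto_upperbound)
    have "((\<lambda>x. \<Sum>n=1..M. divisor_sum n * x ^ n) \<longlongrightarrow> (\<Sum>n=1..M. divisor_sum n * 1 ^ n)) (at_left (1::real))"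
      by (intro tendsto_intros)
    then show "((\<lambda>x. \<Sum>n=1..M. divisor_sum n * x ^ n) \<longlongrightarrow> (\<Sum>n=1..M. divisor_sum n)) (at_left (1::real))"
      by simp
    have "\<forall>\<^sub>F x in at_left (1::real). x \<in> {0<..<1}"
      by (rule eventually_at_left_real) simp
    then show "\<forall>\<^sub>F x in at_left (1::real). (\<Sum>n=1..M. divisor_sum n * x ^ n) \<le> C"
      by eventually_elim (use bound in auto)
  qed simp
  obtain k :: nat where k: "C < real k" using reals_Archimedean2 by blast
  have "real k = (\<Sum>i<k. 1)" by simp
  also have "\<dots> \<le> (\<Sum>i<k. divisor_sum (4 ^ i))" by (intro sum_mono divisor_sum_4_power)
  also have "\<dots> = (\<Sum>n\<in>(\<lambda>i. 4 ^ i) ` {..<k}. divisor_sum n)"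
    by (simp add: sum.reindex inj_on_def)
  also have "\<dots> \<le> (\<Sum>n=1..4 ^ k. divisor_sum n)"
    by (intro sum_mono2) (auto intro!: divisor_sum_nonneg power_increasing simp: Suc_le_eq)
  finally show False using bound1[of "4 ^ k"] k by linarith
qed

end

section \<open>A Mertens-type estimate for real characters\<close>

context real_character
begin

lemma sum_ln_over_id_bounded: "\<bar>\<Sum>n=1..x. \<chi> n * (ln (real n) / real n)\<bar> \<le> 1 + C"
proof (cases "x \<le> 1")
  case True
  then have "x = 0 \<or> x = 1" by auto
  then show ?thesis using C_nonneg by auto
next
  case False
  \<comment> \<open>The function \<open>ln n / n\<close> decreases only beyond \<open>e\<close>, so
    the first two terms are split off before partial summation.\<close>
  have "{1..x} = {1,2} \<union> {3..<Suc x}" "{1,2} \<inter> {3..<Suc x} = {}" using False by auto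
  then have "(\<Sum>n=1..x. \<chi> n * (ln (real n) / real n))
      = (\<Sum>n\<in>{1,2}. \<chi> n * (ln (real n) / real n)) + (\<Sum>n\<in>{3..<Suc x}. \<chi> n * (ln (real n) / real n))"
    by (simp only: sum.union_disjoint finite_insert finite.emptyI finite_atLeastLessThan)
  moreover have "\<bar>\<Sum>n\<in>{1,2}. \<chi> n * (ln (real n) / real n)\<bar> \<le> 1/2"
    using vals[of 2] ln_2_less_1 by auto
  moreover have "\<bar>\<Sum>n\<in>{3..<Suc x}. \<chi> n * (ln (real n) / real n)\<bar> \<le> C * (ln (real 3) / real 3)"
  proof (rule sum_mult_antimono_bound)
    fix k :: nat assume "3 \<le> k"
    then have "exp 1 \<le> real k" using exp_le by linarith
    then show "ln (real (Suc k)) / real (Suc k) \<le> ln (real k) / real k"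
      by (intro ln_x_over_x_mono) auto
  qed auto
  moreover have "C * (ln (real 3) / real 3) \<le> C * 1"
    using C_nonneg ln_le_minus_one[of 3] by (intro mult_left_mono) auto
  ultimately show ?thesis by linarith
qed

text \<open>Writing \<open>ln\<close> as a divisor sum of \<open>mangoldt\<close> turns the bounded
  sum of \<open>\<chi> n * ln n / n\<close> into the sum of \<open>\<chi> d * mangoldt d / d\<close>
  weighted with the partial sums \<open>P (x div d)\<close>. Replacing these by \<open>L\<close>
  costs at most \<open>C * d / x\<close> each, which Chebyshev's bound controls; finally divide by
  \<open>L\<close>, which is nonzero.\<close>

lemma sum_mangoldt_over_id_bounded:
  "\<exists>B. \<forall>x. \<bar>\<Sum>d=1..x. \<chi> d * (mangoldt d / real d)\<bar> \<le> B"
proof (intro exI allI)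
  fix x :: nat
  define P where "P m = (\<Sum>k=1..m. \<chi> k / real k)" for m
  define S where "S = (\<Sum>d=1..x. \<chi> d * (mangoldt d / real d))"
  \<comment> \<open>The part \<open>1 + C\<close> comes from the logarithmic sum and
    \<open>4 * C\<close> from \<open>chebyshev_psi_le\<close>.\<close>
  have "\<bar>L\<bar> * \<bar>S\<bar> \<le> 1 + 5 * C"
  proof (cases "x = 0")
    case True
    then show ?thesis using C_nonneg by (simp add: S_def)
  next
    case False
    have "(\<Sum>n=1..x. \<chi> n * (ln (real n) / real n))
        = (\<Sum>n=1..x. \<Sum>d | d dvd n. \<chi> d * (mangoldt d / real d) * (\<chi> (n div d) / real (n div d)))"
    proof (intro sum.cong refl)
      fix n assume n: "n \<in> {1..x}"
      have "\<chi> n * (ln (real n) / real n) = (\<Sum>d | d dvd n. \<chi> n * (mangoldt d / real n))"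
        using n mangoldt_sum[of n, where ?'a = real]
        by (simp add: sum_distrib_left[symmetric] sum_divide_distrib[symmetric])
      also have "\<dots> = (\<Sum>d | d dvd n. \<chi> d * (mangoldt d / real d) * (\<chi> (n div d) / real (n div d)))"
      proof (intro sum.cong refl)
        fix d assume "d \<in> {d. d dvd n}"
        then obtain k where "n = d * k" by auto
        then show "\<chi> n * (mangoldt d / real n)
            = \<chi> d * (mangoldt d / real d) * (\<chi> (n div d) / real (n div d))"
          using n by (auto simp: mult field_simps)
      qed
      finally show "\<chi> n * (ln (real n) / real n)
          = (\<Sum>d | d dvd n. \<chi> d * (mangoldt d / real d) * (\<chi> (n div d) / real (n div d)))" .
    qed
    also have "\<dots> = (\<Sum>d=1..x. \<Sum>m=1..x div d. \<chi> d * (mangoldt d / real d) * (\<chi> m / real m))"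
      by (rule sum_divisors_swap)
    also have "\<dots> = (\<Sum>d=1..x. \<chi> d * (mangoldt d / real d) * P (x div d))"
      by (simp only: P_def sum_distrib_left)
    finally have A: "(\<Sum>n=1..x. \<chi> n * (ln (real n) / real n)) = \<dots>" .
    have "L * S = (\<Sum>d=1..x. \<chi> d * (mangoldt d / real d) * (L - P (x div d)))
        + (\<Sum>n=1..x. \<chi> n * (ln (real n) / real n))"
      unfolding A S_def sum_distrib_left sum.distrib[symmetric]
      by (intro sum.cong) (auto simp: algebra_simps diff_divide_distrib)
    moreover have "\<bar>\<Sum>d=1..x. \<chi> d * (mangoldt d / real d) * (L - P (x div d))\<bar>
        \<le> (\<Sum>d=1..x. C / real x * mangoldt d)"
    proof (rule order_trans[OF sum_abs sum_mono])
      fix d assume d: "d \<in> {1..x}"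
      have "x \<le> d * Suc (x div d)" using d dividend_less_times_div[of d x] by simp
      then have "real x \<le> real d * real (Suc (x div d))" by (metis of_nat_le_iff of_nat_mult)
      then have "C / real (Suc (x div d)) \<le> C * real d / real x"
        using C_nonneg False by (simp add: divide_simps mult.commute mult_left_mono del: of_nat_Suc)
           (metis mult.assoc mult.commute mult_left_mono)
      then have le: "\<bar>L - P (x div d)\<bar> \<le> C * real d / real x"
        using L_approx[of "x div d"] by (simp add: P_def del: of_nat_Suc)
      have "\<bar>\<chi> d * (mangoldt d / real d) * (L - P (x div d))\<bar>
          = \<bar>\<chi> d\<bar> * ((mangoldt d / real d) * \<bar>L - P (x div d)\<bar>)"
        by (simp add: abs_mult)
      also have "\<dots> \<le> 1 * ((mangoldt d / real d) * (C * real d / real x))"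
        using abs_le_1[of d] le by (intro mult_mono) (auto simp: mangoldt_nonneg zero_le_mult_iff zero_le_divide_iff)
      also have "\<dots> = C / real x * mangoldt d" using d by (simp add: field_simps)
      finally show "\<bar>\<chi> d * (mangoldt d / real d) * (L - P (x div d))\<bar> \<le> C / real x * mangoldt d" .
    qed
    moreover have "(\<Sum>d=1..x. C / real x * mangoldt d) \<le> 4 * C"
    proof -
      have "(\<Sum>d=1..x. C / real x * mangoldt d) = C / real x * chebyshev_psi x"
        by (simp add: chebyshev_psi_def sum_distrib_left)
      also have "\<dots> \<le> C / real x * (4 * real x)"
        using C_nonneg by (intro mult_left_mono chebyshev_psi_le) auto
      finally show ?thesis using False by simp
    qed
    ultimately have "\<bar>L * S\<bar> \<le> 1 + 5 * C" using sum_ln_over_id_bounded[of x] by linarith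
    then show ?thesis by (simp add: abs_mult)
  qed
  then show "\<bar>\<Sum>d=1..x. \<chi> d * (mangoldt d / real d)\<bar> \<le> (1 + 5 * C) / \<bar>L\<bar>"
    using L_nonzero by (simp add: S_def field_simps)
qed

end

section \<open>Primes with prescribed values of several real characters\<close>

text \<open>Since \<open>ln n <= 2 * sqrt n\<close>, each term is at most
  \<open>2 / n^(3/2)\<close>, which is at most the drop of \<open>4 / sqrt n\<close> from
  \<open>n - 1\<close> to \<open>n\<close>.\<close>

lemma sum_ln_over_square_le: "(\<Sum>m=1..x. ln (real m) / (real m)\<^sup>2) \<le> 4"
proof -
  have "(\<Sum>m=1..x. ln (real m) / (real m)\<^sup>2) \<le> 4 - 4 / sqrt (real x)" if "x \<ge> 1"
    using that
  proof (induction x rule: dec_induct)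
    case base
    show ?case by simp
  next
    case (step n)
    define s t where "s = sqrt (real n)" and "t = sqrt (real (Suc n))"
    have st: "0 < s" "s < t" "s\<^sup>2 = real n" "t\<^sup>2 = real (Suc n)" "t\<^sup>2 = s\<^sup>2 + 1"
      using step.hyps by (auto simp: s_def t_def)
    have "ln (real (Suc n)) = 2 * ln t" unfolding st(4)[symmetric] using st(1,2) by (simp add: ln_realpow)
    also have "\<dots> \<le> 2 * t" using st ln_le_minus_one[of t] by simp
    finally have "ln (real (Suc n)) / (real (Suc n))\<^sup>2 \<le> 2 * t / (real (Suc n))\<^sup>2"
      by (intro divide_right_mono) auto
    also have "\<dots> = 2 / t ^ 3"
      unfolding st(4)[symmetric] using st(1,2) by (simp add: field_simps power_numeral_reduce)
    also have "\<dots> \<le> 4 / s - 4 / t"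
    proof -
      have "s * (t + s) \<le> t * (2 * t)" using st by (intro mult_mono) auto
      moreover have "(t - s) * (t + s) = 1" using st(5) by (simp add: algebra_simps power2_eq_square)
      ultimately have "s * (t + s) * ((t - s) * (t + s)) \<le> 2 * t\<^sup>2 * ((t - s) * (t + s))"
        by (simp add: power2_eq_square)
      then have "(t + s) * s * ((t - s) * (t + s)) \<le> (t + s) * (2 * t\<^sup>2 * (t - s))"
        by (simp add: mult_ac)
      then have "s * ((t - s) * (t + s)) \<le> 2 * t\<^sup>2 * (t - s)" using st
        by (metis (no_types, lifting) add_pos_pos mult.assoc mult_le_cancel_left_pos order_less_trans)
      then have "s \<le> 2 * t\<^sup>2 * (t - s)" using \<open>(t - s) * (t + s) = 1\<close> by simp
      then have "2 * s \<le> 4 * (t - s) * t\<^sup>2" by (simp add: algebra_simps)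
      then have "2 \<le> 4 * (t - s) * t\<^sup>2 / s" using st(1) by (simp add: pos_le_divide_eq)
      also have "\<dots> = (4 / s - 4 / t) * t ^ 3"
        using st(1,2) by (simp add: field_simps power_numeral_reduce)
      finally show ?thesis using st(1,2) by (simp add: pos_divide_le_eq)
    qed
    finally show ?case using step by (simp add: s_def t_def del: of_nat_Suc)
  qed
  moreover have "4 - 4 / sqrt (real x) \<le> 4" by simp
  ultimately show ?thesis by (cases "1 \<le> x") (rule order_trans, auto)
qed

text \<open>Even powers of a prime do not see the sign of a character at that prime; this bound
  makes their contribution negligible.\<close>

lemma sum_mangoldt_squares_le:
  "(\<Sum>n | n \<in> {1..x} \<and> (\<exists>m. n = m\<^sup>2). mangoldt n / real n) \<le> 8"
proof -
  have "{n. n \<in> {1..x} \<and> (\<exists>m. n = m\<^sup>2)} \<subseteq> (\<lambda>m. m\<^sup>2) ` {1..x}"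
  proof clarsimp
    fix m assume "Suc 0 \<le> m\<^sup>2" "m\<^sup>2 \<le> x"
    then have "1 \<le> m" by (cases m) auto
    moreover have "m \<le> m\<^sup>2" by (simp add: power2_eq_square)
    ultimately show "m\<^sup>2 \<in> (\<lambda>m. m\<^sup>2) ` {Suc 0..x}" using \<open>m\<^sup>2 \<le> x\<close> by auto
  qed
  then have "(\<Sum>n | n \<in> {1..x} \<and> (\<exists>m. n = m\<^sup>2). mangoldt n / real n)
      \<le> (\<Sum>n\<in>(\<lambda>m. m\<^sup>2) ` {1..x}. mangoldt n / real n)"
    by (intro sum_mono2) (auto simp: mangoldt_nonneg)
  also have "\<dots> = (\<Sum>m=1..x. mangoldt (m\<^sup>2) / real (m\<^sup>2))"
    by (subst sum.reindex) (auto simp: inj_on_def power2_eq_iff)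
  also have "\<dots> \<le> (\<Sum>m=1..x. 2 * (ln (real m) / (real m)\<^sup>2))"
  proof (rule sum_mono)
    fix m assume "m \<in> {1..x}"
    then have "mangoldt (m\<^sup>2) \<le> 2 * ln (real m)"
      using mangoldt_le[of "m\<^sup>2"] by (simp add: ln_realpow)
    then show "mangoldt (m\<^sup>2) / real (m\<^sup>2) \<le> 2 * (ln (real m) / (real m)\<^sup>2)"
      by (simp add: divide_right_mono)
  qed
  also have "\<dots> \<le> 8" unfolding sum_distrib_left[symmetric] using sum_ln_over_square_le[of x] by simp
  finally show ?thesis .
qed

lemma sum_UN_le:
  fixes g :: "'b \<Rightarrow> 'c::ordered_ab_group_add"
  assumes "finite F" and "\<And>p. finite (A p)" and nonneg: "\<And>x. 0 \<le> g x"
  shows "sum g (\<Union>p\<in>F. A p) \<le> (\<Sum>p\<in>F. sum g (A p))"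
  using assms(1)
proof (induction F rule: finite_induct)
  case (insert p F)
  have "sum g (A p \<union> (\<Union>p\<in>F. A p)) \<le> sum g (A p) + sum g (\<Union>p\<in>F. A p)"
    using sum.union_inter[of "A p" "\<Union>p\<in>F. A p" g] insert.hyps assms(2)
      sum_nonneg[of "A p \<inter> (\<Union>p\<in>F. A p)" g] nonneg
    by (metis (no_types, lifting) finite_UN le_add_same_cancel1)
  then show ?case using insert by (auto intro: order_trans)
qed simp

text \<open>Controls the powers of the exceptional primes: for each \<open>p\<close> the geometric
  series of \<open>1 / p^k\<close> over \<open>k >= 1\<close> is at most 1.\<close>

lemma sum_mangoldt_prime_powers_le:
  assumes "finite F" and "\<And>p. p \<in> F \<Longrightarrow> prime p"
  shows "(\<Sum>n | n \<in> {1..x} \<and> (\<exists>p\<in>F. \<exists>k>0. n = p ^ k). mangoldt n / real n) \<le> (\<Sum>p\<in>F. ln (real p))"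
proof -
  have "{n. n \<in> {1..x} \<and> (\<exists>p\<in>F. \<exists>k>0. n = p ^ k)} \<subseteq> (\<Union>p\<in>F. (\<lambda>k. p ^ k) ` {1..x})"
  proof clarsimp
    fix p k :: nat assume *: "p ^ k \<le> x" "p \<in> F" "0 < k"
    then have "k < p ^ k" using prime_gt_1_nat[OF assms(2)] by (intro power_gt_expt) auto
    then have "p ^ k \<in> (\<lambda>k. p ^ k) ` {Suc 0..x}" using * by (intro image_eqI[of _ _ k]) auto
    then show "\<exists>p'\<in>F. p ^ k \<in> (\<lambda>k. p' ^ k) ` {Suc 0..x}" using * by blast
  qed
  then have "(\<Sum>n | n \<in> {1..x} \<and> (\<exists>p\<in>F. \<exists>k>0. n = p ^ k). mangoldt n / real n)
      \<le> (\<Sum>n\<in>(\<Union>p\<in>F. (\<lambda>k. p ^ k) ` {1..x}). mangoldt n / real n)"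
    using assms(1) by (intro sum_mono2) (auto simp: mangoldt_nonneg)
  also have "\<dots> \<le> (\<Sum>p\<in>F. \<Sum>n\<in>(\<lambda>k. p ^ k) ` {1..x}. mangoldt n / real n)"
    using assms(1) by (intro sum_UN_le) (auto simp: mangoldt_nonneg)
  also have "\<dots> \<le> (\<Sum>p\<in>F. ln (real p))"
  proof (rule sum_mono)
    fix p assume "p \<in> F"
    then have p: "prime p" "p > 1" using assms(2) prime_gt_1_nat by auto
    have geo: "(\<Sum>k=1..x. 1 / real p ^ k) \<le> 1 - 1 / real p ^ x"
    proof (induction x)
      case (Suc x)
      have "2 * (1 / real p ^ Suc x) \<le> 1 / real p ^ x" using p(2) by (simp add: field_simps)
      then show ?case using Suc.IH by simp
    qed simp
    have "(\<Sum>n\<in>(\<lambda>k. p ^ k) ` {1..x}. mangoldt n / real n) = (\<Sum>k=1..x. mangoldt (p ^ k) / real (p ^ k))"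
      using p(2) by (subst sum.reindex) (auto simp: inj_on_def)
    also have "\<dots> = ln (real p) * (\<Sum>k=1..x. 1 / real p ^ k)"
      using p(1) by (simp add: sum_distrib_left mangoldt_primepow)
    also have "\<dots> \<le> ln (real p) * 1"
    proof (rule mult_left_mono)
      show "(\<Sum>k=1..x. 1 / real p ^ k) \<le> 1" using geo by (smt (verit) of_nat_0_le_iff zero_le_divide_1_iff zero_le_power)
    qed (use p in auto)
    finally show "(\<Sum>n\<in>(\<lambda>k. p ^ k) ` {1..x}. mangoldt n / real n) \<le> ln (real p)" by simp
  qed
  finally show ?thesis .
qed

text \<open>The weight \<open>D n\<close>, the product of the factors
  \<open>\<epsilon> i * \<chi> i n + 1\<close>, expands over the subsets of \<open>I\<close>. The
  empty subset contributes at least \<open>ln x - 1\<close> and every other one a bounded amount.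
  Without a suitable prime, \<open>D\<close> would vanish at all odd powers of primes outside
  \<open>F\<close>, and the weighted sum would stay bounded.\<close>

theorem exists_prime_with_character_values:
  fixes \<chi> :: "'i \<Rightarrow> nat \<Rightarrow> real" and \<epsilon> :: "'i \<Rightarrow> real"
  assumes I: "finite I" and F: "finite F"
    and mult: "\<And>i m n. i \<in> I \<Longrightarrow> \<chi> i (m * n) = \<chi> i m * \<chi> i n"
    and one: "\<And>i. i \<in> I \<Longrightarrow> \<chi> i 1 = 1"
    and vals: "\<And>i n. i \<in> I \<Longrightarrow> \<chi> i n \<in> {-1, 0, 1}"
    and nonzero: "\<And>i p. i \<in> I \<Longrightarrow> prime p \<Longrightarrow> p \<notin> F \<Longrightarrow> \<chi> i p \<noteq> 0"
    and \<epsilon>: "\<And>i. i \<in> I \<Longrightarrow> \<epsilon> i \<in> {-1, 1}"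
    and bounded: "\<And>T. T \<subseteq> I \<Longrightarrow> T \<noteq> {} \<Longrightarrow> \<exists>C. \<forall>m n. \<bar>\<Sum>k\<in>{m..<n}. \<Prod>i\<in>T. \<chi> i k\<bar> \<le> C"
  shows "\<exists>q. prime q \<and> q \<notin> F \<and> (\<forall>i\<in>I. \<chi> i q = \<epsilon> i)"
proof (rule ccontr)
  assume no_prime: "\<not> ?thesis"
  define \<psi> where "\<psi> T n = (\<Prod>i\<in>T. \<chi> i n)" for T n
  define D where "D n = (\<Prod>i\<in>I. \<epsilon> i * \<chi> i n + 1)" for n
  have "\<exists>B. \<forall>x. \<bar>\<Sum>d=1..x. \<psi> T d * (mangoldt d / real d)\<bar> \<le> B" if T: "T \<subseteq> I" "T \<noteq> {}" for T
  proof -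
    obtain C where C: "\<And>m n. \<bar>\<Sum>k\<in>{m..<n}. \<psi> T k\<bar> \<le> C"
      using bounded[OF T] unfolding \<psi>_def by blast
    have "\<psi> T n \<in> {-1, 0, 1}" for n
      using finite_subset[OF T(1) I] T(1) unfolding \<psi>_def
    proof (induction T rule: finite_induct)
      case (insert i T)
      then show ?case using vals[of i n] by auto
    qed simp
    then interpret real_character "\<psi> T" C
      using C T by unfold_locales (auto simp: \<psi>_def mult one[simplified] subset_iff prod.distrib[symmetric] intro!: prod.cong prod.neutral)
    show ?thesis by (rule sum_mangoldt_over_id_bounded)
  qed
  then obtain B where B: "\<And>T x. T \<subseteq> I \<Longrightarrow> T \<noteq> {} \<Longrightarrow> \<bar>\<Sum>d=1..x. \<psi> T d * (mangoldt d / real d)\<bar> \<le> B T"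
    by metis
  have D_expand: "D n = (\<Sum>T\<in>Pow I. (\<Prod>i\<in>T. \<epsilon> i) * \<psi> T n)" for n
    unfolding D_def \<psi>_def using I by (subst prod_add) (auto simp: prod.distrib)
  define B' where "B' = (\<Sum>T\<in>Pow I - {{}}. B T)"
  have lower: "ln (real x) - 1 - B' \<le> (\<Sum>n=1..x. D n * (mangoldt n / real n))" if "x > 0" for x
  proof -
    let ?S = "\<lambda>T. \<Sum>n=1..x. \<psi> T n * (mangoldt n / real n)"
    have "(\<Sum>n=1..x. D n * (mangoldt n / real n)) = (\<Sum>T\<in>Pow I. (\<Prod>i\<in>T. \<epsilon> i) * ?S T)"
      unfolding D_expand sum_distrib_right sum_distrib_left
      by (subst sum.swap) (simp add: mult.assoc)
    also have "\<dots> = ?S {} + (\<Sum>T\<in>Pow I - {{}}. (\<Prod>i\<in>T. \<epsilon> i) * ?S T)"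
      using I by (subst sum.remove[of _ "{}"]) auto
    finally have eq: "(\<Sum>n=1..x. D n * (mangoldt n / real n)) = \<dots>" .
    have "\<bar>\<Sum>T\<in>Pow I - {{}}. (\<Prod>i\<in>T. \<epsilon> i) * ?S T\<bar> \<le> B'"
      unfolding B'_def
    proof (rule order_trans[OF sum_abs sum_mono])
      fix T assume T: "T \<in> Pow I - {{}}"
      have "\<bar>\<Prod>i\<in>T. \<epsilon> i\<bar> = 1"
        unfolding abs_prod using T \<epsilon> by (intro prod.neutral) force
      then show "\<bar>(\<Prod>i\<in>T. \<epsilon> i) * ?S T\<bar> \<le> B T" using B[of T x] T by (simp add: abs_mult)
    qed
    moreover have "?S {} \<ge> ln (real x) - 1"
      using sum_mangoldt_over_id_ge[OF that] by (simp add: \<psi>_def)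
    ultimately show ?thesis unfolding eq by linarith
  qed
  have D_bounds: "0 \<le> D n" "D n \<le> 2 ^ card I" for n
  proof -
    have fac: "0 \<le> \<epsilon> i * \<chi> i n + 1 \<and> \<epsilon> i * \<chi> i n + 1 \<le> 2" if "i \<in> I" for i
      using vals[OF that, of n] \<epsilon>[OF that] by auto
    then show "0 \<le> D n" unfolding D_def by (intro prod_nonneg) auto
    have "D n \<le> (\<Prod>i\<in>I. 2)" unfolding D_def using fac by (intro prod_mono) auto
    then show "D n \<le> 2 ^ card I" by simp
  qed
  define F' where "F' = {p\<in>F. prime p}"
  let ?Q = "\<lambda>n. \<exists>m::nat. n = m\<^sup>2" and ?R = "\<lambda>n. \<exists>p\<in>F'. \<exists>k>0. n = p ^ k"
  have vanish: "mangoldt n = (0::real) \<or> D n = 0" if "\<not> ?Q n" "\<not> ?R n" for n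
  proof (rule ccontr)
    assume *: "\<not> ?thesis"
    then have "primepow n" by (auto simp: mangoldt_def split: if_splits)
    then obtain p k where pk: "prime p" "k > 0" "n = p ^ k" unfolding primepow_def by blast
    have "p \<notin> F'" using that(2) pk by blast
    then have "p \<notin> F" using pk(1) by (simp add: F'_def)
    have "odd k"
    proof
      assume "even k"
      then have "n = (p ^ (k div 2))\<^sup>2" using pk(3) by (simp flip: power_mult)
      then show False using that(1) by blast
    qed
    \<comment> \<open>Some character has the wrong sign at \<open>p\<close>. The exponent
      \<open>k\<close> is odd, so the sign is also wrong at \<open>n\<close>, and the corresponding
      factor of \<open>D n\<close> is zero.\<close>
    obtain i where i: "i \<in> I" "\<chi> i p \<noteq> \<epsilon> i" using no_prime pk(1) \<open>p \<notin> F\<close> by blast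
    have "\<chi> i p = - \<epsilon> i"
      using i vals[OF i(1), of p] \<epsilon>[OF i(1)] nonzero[OF i(1) pk(1) \<open>p \<notin> F\<close>] by auto
    moreover have "\<chi> i (p ^ j) = \<chi> i p ^ j" for j
      by (induction j) (use mult[OF i(1)] one[OF i(1)] in auto)
    ultimately have "\<epsilon> i * \<chi> i n + 1 = 0"
      using pk(3) \<epsilon>[OF i(1)] \<open>odd k\<close> by auto
    then have "D n = 0" unfolding D_def using I i(1) by (auto simp: prod_zero_iff)
    then show False using * by simp
  qed
  have upper: "(\<Sum>n=1..x. D n * (mangoldt n / real n)) \<le> 2 ^ card I * (8 + (\<Sum>p\<in>F'. ln (real p)))" for x
  proof -
    let ?g = "\<lambda>n. mangoldt n / real n"
    have g: "0 \<le> ?g n" for n by (simp add: mangoldt_nonneg)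
    have "(\<Sum>n=1..x. D n * ?g n) \<le> (\<Sum>n=1..x. 2 ^ card I * ((if ?Q n then ?g n else 0) + (if ?R n then ?g n else 0)))"
    proof (rule sum_mono)
      fix n
      show "D n * ?g n \<le> 2 ^ card I * ((if ?Q n then ?g n else 0) + (if ?R n then ?g n else 0))"
      proof (cases "?Q n \<or> ?R n")
        case True
        have "D n * ?g n \<le> 2 ^ card I * ?g n" using D_bounds g by (intro mult_right_mono) auto
        also have "\<dots> \<le> 2 ^ card I * ((if ?Q n then ?g n else 0) + (if ?R n then ?g n else 0))"
        proof (rule mult_left_mono)
          have "?g n \<le> (if q then ?g n else 0) + (if r then ?g n else 0)" if "q \<or> r" for q r
            using that g[of n] by auto
          from this[OF True] show "?g n \<le> (if ?Q n then ?g n else 0) + (if ?R n then ?g n else 0)" .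
        qed simp
        finally show ?thesis .
      next
        case False
        then have "D n * ?g n = 0" using vanish[of n] by auto
        then show ?thesis unfolding if_not_P[OF False[unfolded de_Morgan_disj, THEN conjunct1]]
            if_not_P[OF False[unfolded de_Morgan_disj, THEN conjunct2]] by (simp only: add_0_left mult_zero_right order_refl)
      qed
    qed
    also have "\<dots> = 2 ^ card I * ((\<Sum>n | n \<in> {1..x} \<and> ?Q n. ?g n) + (\<Sum>n | n \<in> {1..x} \<and> ?R n. ?g n))"
      by (simp only: sum_distrib_left[symmetric] sum.distrib sum.inter_filter[symmetric] finite_atLeastAtMost)
    also have "\<dots> \<le> 2 ^ card I * (8 + (\<Sum>p\<in>F'. ln (real p)))"
      using F by (intro mult_left_mono add_mono sum_mangoldt_squares_le sum_mangoldt_prime_powers_le)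
        (auto simp: F'_def)
    finally show ?thesis .
  qed
  define K where "K = 1 + B' + 2 ^ card I * (8 + (\<Sum>p\<in>F'. ln (real p)))"
  obtain x :: nat where x: "exp K < real x" using reals_Archimedean2 by blast
  then have "0 < real x" by (smt (verit) exp_gt_zero)
  then have "K < ln (real x)" using x by (metis exp_less_cancel_iff exp_ln)
  then show False using lower[of x] upper[of x] \<open>0 < real x\<close> unfolding K_def by linarith
qed

section \<open>Primes with prescribed quadratic residue symbols\<close>

lemma Legendre_range: "Legendre a p \<in> {-1, 0, 1}"
  by (simp add: Legendre_def)

lemma Legendre_cong: "[a = b] (mod p) \<Longrightarrow> Legendre a p = Legendre b p"
  unfolding Legendre_def QuadRes_def by (simp add: cong_def)

text \<open>Two such values differ by at most 2. This turns the congruences of Euler's criterion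
  into equalities.\<close>

lemma cong_imp_eq_sign:
  fixes x y p :: int
  assumes "[x = y] (mod p)" "2 < p" "x \<in> {-1, 0, 1}" "y \<in> {-1, 0, 1}"
  shows "x = y"
proof -
  have "p dvd x - y" using assms(1) by (simp add: cong_iff_dvd_diff)
  moreover have "\<bar>x - y\<bar> < p" using assms by auto
  ultimately show ?thesis by (metis dvd_imp_le_int linorder_not_less abs_of_pos assms(2) eq_iff_diff_eq_0
      order_less_trans zero_less_numeral)
qed

lemma Legendre_mult:
  assumes "prime p" "2 < p"
  shows "Legendre (a * b) (int p) = Legendre a (int p) * Legendre b (int p)"
proof (rule cong_imp_eq_sign)
  have "[Legendre (a * b) (int p) = a ^ ((p - 1) div 2) * b ^ ((p - 1) div 2)] (mod int p)"
    using euler_criterion[OF assms, of "a * b"] by (simp add: power_mult_distrib)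
  moreover have "[Legendre a (int p) * Legendre b (int p)
      = a ^ ((p - 1) div 2) * b ^ ((p - 1) div 2)] (mod int p)"
    using euler_criterion[OF assms] by (intro cong_mult)
  ultimately show "[Legendre (a * b) (int p) = Legendre a (int p) * Legendre b (int p)] (mod int p)"
    using cong_sym cong_trans by blast
  show "Legendre (a * b) (int p) \<in> {-1, 0, 1}" by (rule Legendre_range)
  show "Legendre a (int p) * Legendre b (int p) \<in> {-1, 0, 1}"
    using Legendre_range[of a "int p"] Legendre_range[of b "int p"] by auto
qed (use assms in auto)

lemma Legendre_prod:
  assumes "prime p" "2 < p"
  shows "Legendre (\<Prod>i\<in>A. f i) (int p) = (\<Prod>i\<in>A. Legendre (f i) (int p))"
proof (induction A rule: infinite_finite_induct)
  have "\<not> [1 = 0] (mod int p)" "QuadRes (int p) 1"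
    using assms by (auto simp: cong_def QuadRes_def intro: exI[of _ 1])
  then have "Legendre 1 (int p) = 1" by (simp add: Legendre_def)
  then show "Legendre (\<Prod>i\<in>{}. f i) (int p) = (\<Prod>i\<in>{}. Legendre (f i) (int p))"
    "infinite A \<Longrightarrow> Legendre (\<Prod>i\<in>A. f i) (int p) = (\<Prod>i\<in>A. Legendre (f i) (int p))" for A by auto
qed (use Legendre_mult[OF assms] in auto)

lemma Legendre_neq_0_iff: "Legendre a p \<noteq> 0 \<longleftrightarrow> \<not> p dvd a"
  by (simp add: Legendre_def cong_0_iff)

lemma Legendre_eq_1_imp_square: "Legendre a p = 1 \<Longrightarrow> \<exists>y. [y\<^sup>2 = a] (mod p)"
  unfolding Legendre_def QuadRes_def by (auto split: if_splits)

lemma Legendre_minus_1: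
  assumes "prime p" "2 < p"
  shows "Legendre (-1) (int p) = (-1) ^ ((p - 1) div 2)"
proof (rule cong_imp_eq_sign)
  show "(-1) ^ ((p - 1) div 2) \<in> {-1, 0, 1 :: int}"
    by (metis insertCI neg_one_even_power neg_one_odd_power)
qed (use assms euler_criterion[OF assms, of "-1"] Legendre_range in auto)

text \<open>Gauss's lemma: among the numbers \<open>2 * x\<close> with \<open>1 <= x <= h\<close>,
  those exceeding \<open>h\<close> are the ones with \<open>x > h div 2\<close>.\<close>

lemma Legendre_2:
  assumes "prime p" "2 < p"
  defines "h \<equiv> (p - 1) div 2"
  shows "Legendre 2 (int p) = (-1) ^ (h - h div 2)"
proof -
  have "odd p" using assms prime_odd_nat by blast
  then have p: "int p = 2 * int h + 1" using assms(2) by (auto simp: h_def elim: oddE)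
  interpret GAUSS p 2
    using assms p by unfold_locales (auto simp: cong_0_iff zdvd_not_zless)
  have h: "(int p - 1) div 2 = int h" using p by simp
  have "C = (\<lambda>x. 2 * x) ` {0 <.. int h}"
    unfolding C_def B_def A_def h image_image using p by (intro image_cong) auto
  then have "E = (\<lambda>x. 2 * x) ` {int (h div 2) <.. int h}"
    unfolding E_def h by (auto simp: image_iff)
  then have "card E = h - h div 2"
    by (simp add: card_image inj_on_def)
  then show ?thesis using gauss_lemma by simp
qed

definition character_mod_4 :: "nat \<Rightarrow> int" where
  "character_mod_4 m = (if m mod 4 = 1 then 1 else if m mod 4 = 3 then -1 else 0)"

text \<open>Of the nontrivial characters modulo 8 this is the even one, the symbol (2/m);
  \<open>character_mod_4\<close> is the symbol (-1/m) for odd \<open>m\<close>.\<close>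

definition character_mod_8 :: "nat \<Rightarrow> int" where
  "character_mod_8 m = (if m mod 8 \<in> {1, 7} then 1 else if m mod 8 \<in> {3, 5} then -1 else 0)"

lemma character_mod_4_mult: "character_mod_4 (m * n) = character_mod_4 m * character_mod_4 n"
proof -
  have "m mod 4 \<in> {0,1,2,3}" "n mod 4 \<in> {0,1,2,3}" by auto
  then show ?thesis unfolding character_mod_4_def mod_mult_eq[of m 4 n, symmetric] by auto
qed

lemma character_mod_8_mult: "character_mod_8 (m * n) = character_mod_8 m * character_mod_8 n"
proof -
  define c where "c r = (if r \<in> {1, 7} then 1 else if r \<in> {3, 5} then -1 else 0 :: int)" for r :: nat
  have "\<forall>i\<in>{..<8}. \<forall>j\<in>{..<8}. c (i * j mod 8) = c i * c j"
    by (simp add: c_def lessThan_nat_numeral lessThan_Suc)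
  then have "c ((m mod 8) * (n mod 8) mod 8) = c (m mod 8) * c (n mod 8)" by simp
  then show ?thesis unfolding character_mod_8_def c_def[symmetric] by (simp add: mod_mult_eq)
qed

lemma Legendre_minus_2:
  assumes "prime p" "2 < p"
  shows "Legendre (-2) (int p) = character_mod_4 p * character_mod_8 p"
proof -
  define k h where "k = p div 8" and "h = (p - 1) div 2"
  \<comment> \<open>With \<open>p = 8 * k + r\<close> the exponents are \<open>4 * k + i\<close> and
    \<open>2 * k + j\<close>, so only the parities of \<open>i\<close> and \<open>j\<close>
    matter.\<close>
  have sign: "(-1) ^ h * (-1) ^ (h - h div 2) = character_mod_4 p * character_mod_8 p"
    if "h = 4 * k + i" "h - h div 2 = 2 * k + j" "p mod 8 = r"
      "(i, j, r) \<in> {(0, 0, 1), (1, 1, 3), (2, 1, 5), (3, 2, 7)}" for i j r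
  proof -
    have "p mod 4 = r mod 4"
      using that(3) by (metis mod_mod_cancel dvd_triv_left mult_2_right numeral_Bit0 mult_2)
    then show ?thesis
      by (subst that(2), subst that(1)) (use that(3,4) in
        \<open>auto simp: character_mod_4_def character_mod_8_def power_add power_mult\<close>)
  qed
  have "odd p" using assms prime_odd_nat by blast
  then have "p mod 8 \<in> {1, 3, 5, 7}" by (simp; presburger)
  moreover have "p = 8 * k + p mod 8" unfolding k_def by (rule mult_div_mod_eq[symmetric])
  ultimately have "p = 8 * k + 1 \<or> p = 8 * k + 3 \<or> p = 8 * k + 5 \<or> p = 8 * k + 7"
    by (metis insert_iff empty_iff)
  then consider "p = 8 * k + 1" | "p = 8 * k + 3" | "p = 8 * k + 5" | "p = 8 * k + 7"
    by blast
  then have "(-1) ^ h * (-1) ^ (h - h div 2) = character_mod_4 p * character_mod_8 p"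
  proof cases
    case 1 show ?thesis by (rule sign[of 0 0 1]) (simp_all add: 1 h_def)
  next
    case 2 show ?thesis by (rule sign[of 1 1 3]) (simp_all add: 2 h_def)
  next
    case 3 show ?thesis by (rule sign[of 2 1 5]) (simp_all add: 3 h_def)
  next
    case 4 show ?thesis by (rule sign[of 3 2 7]) (simp_all add: 4 h_def)
  qed
  moreover have "Legendre (-2) (int p) = Legendre (-1) (int p) * Legendre 2 (int p)"
    using Legendre_mult[OF assms, of "-1" 2] by simp
  ultimately show ?thesis
    by (simp add: Legendre_minus_1[OF assms] Legendre_2[OF assms] h_def)
qed

text \<open>Otherwise squaring would map \<open>{1..<p}\<close> onto itself and so be injective
  there, but 1 and \<open>p - 1\<close> have the same square.\<close>

lemma exists_nonresidue:
  assumes "prime p" "2 < p"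
  shows "\<exists>c::nat. Legendre (int c) (int p) = -1"
proof (rule ccontr)
  assume no: "\<not> ?thesis"
  define f where "f x = x * x mod p" for x
  have "{1..<p} \<subseteq> f ` {1..<p}"
  proof
    fix c assume c: "c \<in> {1..<p}"
    then have "\<not> int p dvd int c" by (auto dest: dvd_imp_le)
    then have "Legendre (int c) (int p) = 1"
      using no Legendre_neq_0_iff[of "int c" "int p"] Legendre_range[of "int c" "int p"] by auto
    then obtain y where y: "[y\<^sup>2 = int c] (mod int p)" using Legendre_eq_1_imp_square by blast
    define x where "x = nat (y mod int p)"
    have x: "int x = y mod int p" using assms by (simp add: x_def)
    have "int (f x) = int c mod int p"
      using y by (simp add: f_def zmod_int x cong_def power2_eq_square mod_mult_eq)
    then have "f x = c" using c by (simp flip: zmod_int)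
    moreover have "x \<in> {1..<p}"
    proof -
      have "int x < int p" using x assms by simp
      moreover have "x \<noteq> 0"
      proof
        assume "x = 0"
        then have "c = 0" using \<open>f x = c\<close> by (simp add: f_def)
        then show False using c by simp
      qed
      ultimately show ?thesis by auto
    qed
    ultimately show "c \<in> f ` {1..<p}" by blast
  qed
  then have "inj_on f {1..<p}" by (intro finite_surj_inj) auto
  moreover have "f 1 = f (p - 1)"
  proof -
    obtain m where "p = Suc (Suc m)" using assms by (metis Suc_lessD less_imp_Suc_add add_Suc numeral_2_eq_2)
    then have "(p - 1) * (p - 1) = 1 + m * p" by (simp add: algebra_simps)
    then have "f (p - 1) = 1 mod p" by (simp only: f_def mod_mult_self1)
    then show ?thesis by (simp add: f_def)
  qed
  ultimately have "1 = p - 1" using assms by (auto dest!: inj_onD)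
  then show False using assms by simp
qed

section \<open>Bounded character sums and the choice of the auxiliary prime\<close>

text \<open>A vanishing sum over one period makes the initial sums \<open>G\<close> periodic, hence
  at most \<open>M\<close> in absolute value; an interval is a difference of two of them.\<close>

lemma periodic_sum_bounded:
  fixes f :: "nat \<Rightarrow> real"
  assumes "M > 0" and periodic: "\<And>k. f (k + M) = f k" and zero: "(\<Sum>k<M. f k) = 0"
    and abs_le: "\<And>k. \<bar>f k\<bar> \<le> 1"
  shows "\<bar>\<Sum>k\<in>{m..<n}. f k\<bar> \<le> 2 * real M"
proof -
  define G where "G n = (\<Sum>k<n. f k)" for n
  have shift: "G (n + M) = G n" for n
  proof -
    have "G (n + M) = G M + (\<Sum>k\<in>{0+M..<n+M}. f k)"
      unfolding G_def lessThan_atLeast0 by (simp add: sum.atLeastLessThan_concat)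
    also have "\<dots> = G n"
      by (subst sum.shift_bounds_nat_ivl) (simp add: periodic zero G_def flip: lessThan_atLeast0)
    finally show ?thesis .
  qed
  have mult: "G (n + q * M) = G n" for n q
    by (induction q) (auto simp: shift simp flip: add.assoc, metis add.commute add.left_commute shift)
  have "G n = G (n mod M)" for n
    using mult[of "n mod M" "n div M"] by simp
  moreover have "\<bar>G (n mod M)\<bar> \<le> real M" for n
  proof -
    have "\<bar>G (n mod M)\<bar> \<le> (\<Sum>k<n mod M. 1)"
      unfolding G_def by (rule order_trans[OF sum_abs sum_mono]) (rule abs_le)
    also have "\<dots> \<le> real M" using assms(1) by (simp add: less_imp_le)
    finally show ?thesis .
  qed
  ultimately have G: "\<bar>G n\<bar> \<le> real M" for n by metis
  show ?thesis
  proof (cases "m \<le> n")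
    case True
    then have "(\<Sum>k\<in>{m..<n}. f k) = G n - G m"
      unfolding G_def lessThan_atLeast0 using sum.atLeastLessThan_concat[of 0 m n f] by simp
    then show ?thesis using G[of n] G[of m] by linarith
  qed simp
qed

text \<open>Multiplication by \<open>c\<close> permutes the residues modulo \<open>M\<close>, so the
  sum over a period is unchanged by the factor \<open>f c\<close>, which is not 1, and must
  vanish.\<close>

lemma character_sum_bounded:
  fixes f :: "nat \<Rightarrow> real"
  assumes "M > 0" and periodic: "\<And>k. f (k + M) = f k"
    and mult: "\<And>m n. f (m * n) = f m * f n" and abs_le: "\<And>k. \<bar>f k\<bar> \<le> 1"
    and c: "coprime c M" "f c \<noteq> 1"
  shows "\<bar>\<Sum>k\<in>{m..<n}. f k\<bar> \<le> 2 * real M"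
proof (rule periodic_sum_bounded)
  have f_mod: "f (k mod M) = f k" for k
  proof -
    have "f (k mod M + q * M) = f (k mod M)" for q
      by (induction q) (auto simp: periodic simp flip: add.assoc, metis add.commute add.left_commute periodic)
    from this[of "k div M"] show ?thesis by simp
  qed
  define g where "g k = c * k mod M" for k
  have "inj_on g {..<M}"
  proof (rule inj_onI)
    fix k l assume "k \<in> {..<M}" "l \<in> {..<M}" "g k = g l"
    moreover from this have "[k = l] (mod M)"
      using c(1) cong_mult_lcancel_nat[of c M k l] by (simp add: g_def cong_def)
    ultimately show "k = l" by (simp add: cong_def)
  qed
  moreover have "g ` {..<M} \<subseteq> {..<M}" using assms(1) by (auto simp: g_def)
  ultimately have "bij_betw g {..<M} {..<M}"
    by (simp add: bij_betw_def endo_inj_surj)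
  then have "(\<Sum>k<M. f k) = (\<Sum>k<M. f (g k))" by (rule sum.reindex_bij_betw[symmetric])
  also have "\<dots> = f c * (\<Sum>k<M. f k)" by (simp add: g_def f_mod mult sum_distrib_left)
  finally show "(\<Sum>k<M. f k) = 0" using c(2) by simp
qed (use assms in auto)

text \<open>As 4 and 8 are not prime, a single index can stand for the two characters of 2-power
  modulus as well as for the Legendre symbols.\<close>

definition quadratic_character :: "nat \<Rightarrow> nat \<Rightarrow> int" where
  "quadratic_character i m = (if i = 4 then character_mod_4 m else if i = 8 then character_mod_8 m
     else Legendre (int m) (int i))"

lemma quadratic_character_prime: "prime p \<Longrightarrow> quadratic_character p m = Legendre (int m) (int p)"
proof -
  have "\<not> prime (4::nat)" "\<not> prime (8::nat)"
    by (auto simp: prime_nat_iff intro!: exI[of _ 2] dest!: spec[of _ 2])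
  then show "prime p \<Longrightarrow> ?thesis" by (auto simp: quadratic_character_def)
qed

lemma quadratic_character_range: "quadratic_character i m \<in> {-1, 0, 1}"
  using Legendre_range[of "int m" "int i"]
  by (simp add: quadratic_character_def character_mod_4_def character_mod_8_def)

lemma quadratic_character_mod:
  "[m = n] (mod i) \<Longrightarrow> quadratic_character i m = quadratic_character i n"
proof -
  assume *: "[m = n] (mod i)"
  then have "Legendre (int m) (int i) = Legendre (int n) (int i)"
    by (intro Legendre_cong) (simp add: cong_int_iff)
  moreover have "i = 4 \<Longrightarrow> character_mod_4 m = character_mod_4 n"
    using * by (simp add: character_mod_4_def cong_def)
  moreover have "i = 8 \<Longrightarrow> character_mod_8 m = character_mod_8 n"
    using * by (simp add: character_mod_8_def cong_def)
  ultimately show ?thesis by (simp add: quadratic_character_def)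
qed

text \<open>The condition modulo 8 says that the characters of index 4 and 8 take the value 1. For
  each index the Chinese remainder theorem gives an argument where that character is -1 and all
  others are 1, so no nonempty product of them is principal.\<close>

lemma exists_prime_with_residue_symbols:
  fixes S :: "nat set" and \<epsilon> :: "nat \<Rightarrow> int"
  assumes S: "finite S" "\<And>p. p \<in> S \<Longrightarrow> prime p \<and> 2 < p"
    and \<epsilon>: "\<And>p. p \<in> S \<Longrightarrow> \<epsilon> p \<in> {-1, 1}"
  shows "\<exists>q. prime q \<and> q \<notin> S \<and> q mod 8 = 1 \<and> (\<forall>p\<in>S. Legendre (int q) (int p) = \<epsilon> p)"
proof -
  define I where "I = insert 4 (insert 8 S)"
  define P where "P = (\<Prod>p\<in>S. p)"
  define M where "M = 8 * P"
  define \<delta> where "\<delta> i = (if i \<in> S then \<epsilon> i else 1)" for i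
  define \<chi> where "\<chi> i m = real_of_int (quadratic_character i m)" for i m
  have not_prime: "4 \<notin> S" "8 \<notin> S"
    using S(2)[of 4] S(2)[of 8] by (auto simp: prime_nat_iff dest!: spec[of _ 2])
  have dvdM: "i dvd M" if "i \<in> I" for i
    using that S(1) by (auto simp: I_def M_def P_def intro: dvd_prodI dvd_mult)
  have "coprime (2::nat) P" unfolding P_def
    using S(2) prime_odd_nat by (intro prod_coprime_right) auto
  then have cop8: "coprime 8 P" using coprime_power_left_iff[of 2 3 P] by simp
  have "P > 0" using S by (auto simp: P_def prime_gt_0_nat intro!: prod_pos)
  then have "M > 0" by (simp add: M_def)
  have mult: "quadratic_character i (m * n) = quadratic_character i m * quadratic_character i n"
    if "i \<in> I" for i m n
    using that S(2) not_prime unfolding I_def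
    by (auto simp: quadratic_character_prime Legendre_mult
        quadratic_character_def[of 4] quadratic_character_def[of 8] character_mod_4_mult character_mod_8_mult)
  have one: "quadratic_character i 1 = 1" if "i \<in> I" for i
  proof -
    have "quadratic_character i 1 * quadratic_character i 1 = quadratic_character i 1"
      using mult[OF that, of 1 1] by simp
    moreover have "quadratic_character i 1 \<noteq> 0"
      using that S(2) not_prime Legendre_neq_0_iff[of 1 "int i"] prime_gt_1_nat[of i] unfolding I_def
      by (auto simp: quadratic_character_prime
        quadratic_character_def[of 4] quadratic_character_def[of 8] character_mod_4_def character_mod_8_def)
    ultimately show ?thesis by simp
  qed
  have separating: "\<exists>c. coprime c M \<and> quadratic_character i c = -1
      \<and> (\<forall>j\<in>I - {i}. quadratic_character j c = 1)" if "i \<in> I" for i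
  proof -
    \<comment> \<open>Modulo 4 the number 7 is -1, while its character modulo 8 is 1; for 5 the
      roles are exchanged.\<close>
    define r where "r = (if i = 4 then 7 else if i = 8 then 5 else 1 :: nat)"
    have "\<exists>s. coprime s P \<and> (\<forall>j\<in>S. quadratic_character j s = (if j = i then -1 else 1))"
    proof (cases "i \<in> S")
      case False
      then show ?thesis using one by (intro exI[of _ 1]) (auto simp: I_def)
    next
      case True
      obtain n where n: "Legendre (int n) (int i) = -1" using exists_nonresidue S(2)[OF True] by blast
      define P' where "P' = (\<Prod>p\<in>S-{i}. p)"
      have P': "P = i * P'" using S(1) True by (simp add: P_def P'_def prod.remove)
      have cop: "coprime i P'" unfolding P'_def
        using S(2) True by (intro prod_coprime_right) (auto intro: primes_coprime)
      then obtain s where s: "[s = n] (mod i)" "[s = 1] (mod P')"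
        using binary_chinese_remainder_nat by blast
      have "coprime s P'" using s(2) by (metis cong_imp_coprime cong_sym coprime_1_left)
      moreover have "coprime s i"
      proof -
        have "coprime n i"
          using n S(2)[OF True] Legendre_neq_0_iff[of "int n" "int i"]
          by (metis coprime_commute int_dvd_int_iff prime_imp_coprime zero_neq_neg_one)
        then show ?thesis using s(1) by (metis cong_imp_coprime cong_sym)
      qed
      moreover have "quadratic_character j s = (if j = i then -1 else 1)" if "j \<in> S" for j
      proof (cases "j = i")
        case True
        then show ?thesis using quadratic_character_mod[OF s(1)] n S(2) that by (simp add: quadratic_character_prime)
      next
        case False
        then have "j dvd P'" using that S(1) by (auto simp: P'_def intro: dvd_prodI)
        then have "[s = 1] (mod j)" using s(2) cong_dvd_modulus_nat by blast
        then show ?thesis using False quadratic_character_mod one that by (simp add: I_def)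
      qed
      ultimately show ?thesis using P' by (auto simp: coprime_mult_right_iff)
    qed
    then obtain s where s: "coprime s P" "\<And>j. j \<in> S \<Longrightarrow> quadratic_character j s = (if j = i then -1 else 1)" by blast
    obtain c where c: "[c = r] (mod 8)" "[c = s] (mod P)"
      using binary_chinese_remainder_nat[OF cop8] by blast
    have "coprime c P" using c(2) s(1) by (metis cong_imp_coprime cong_sym)
    moreover have "coprime r 8" by (auto simp: r_def coprime_iff_gcd_eq_1 gcd_nat.simps gcd_non_0_nat)
    then have "coprime c 8" using c(1) by (metis cong_imp_coprime cong_sym)
    ultimately have "coprime c M" by (simp add: M_def)
    moreover have "quadratic_character j c = (if j = i then -1 else 1)" if "j \<in> S" for j
    proof -
      have "j dvd P" using that S(1) by (auto simp: P_def intro: dvd_prodI)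
      then have "[c = s] (mod j)" using c(2) cong_dvd_modulus_nat by blast
      then show ?thesis using quadratic_character_mod s(2)[OF that] by simp
    qed
    moreover have "quadratic_character 4 c = (if i = 4 then -1 else 1)"
    proof -
      have "[c = r] (mod 4)" using c(1) by (rule cong_dvd_modulus_nat) simp
      then show ?thesis using quadratic_character_mod[of c r 4]
        by (simp add: quadratic_character_def character_mod_4_def r_def)
    qed
    moreover have "quadratic_character 8 c = (if i = 8 then -1 else 1)"
      using quadratic_character_mod[OF c(1)]
      by (simp add: quadratic_character_def character_mod_8_def r_def)
    ultimately show ?thesis using that by (intro exI[of _ c]) (auto simp: I_def split: if_splits)
  qed
  \<comment> \<open>The prime 2 joins the exceptional set because the characters of index 4 and 8
    vanish there.\<close>
  have "\<exists>q. prime q \<and> q \<notin> insert 2 S \<and> (\<forall>i\<in>I. \<chi> i q = real_of_int (\<delta> i))"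
  proof (rule exists_prime_with_character_values)
    show "finite I" "finite (insert 2 S)" using S(1) by (auto simp: I_def)
    show "\<chi> i (m * n) = \<chi> i m * \<chi> i n" if "i \<in> I" for i m n using mult[OF that] by (simp add: \<chi>_def)
    show "\<chi> i 1 = 1" if "i \<in> I" for i using one[OF that] by (simp add: \<chi>_def)
    show vals: "\<chi> i n \<in> {-1, 0, 1}" for i n using quadratic_character_range[of i n] by (auto simp: \<chi>_def)
    show "\<chi> i p \<noteq> 0" if "i \<in> I" "prime p" "p \<notin> insert 2 S" for i p
    proof -
      have "odd p" using that prime_odd_nat prime_ge_2_nat[of p] by (metis insertI1 le_neq_implies_less)
      moreover have "Legendre (int p) (int j) \<noteq> 0" if "j \<in> S" for j
        using \<open>prime p\<close> \<open>p \<notin> insert 2 S\<close> S(2)[OF that] that primes_dvd_imp_eq[of j p]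
        by (auto simp: Legendre_neq_0_iff)
      moreover have "odd p \<Longrightarrow> p mod 4 = 1 \<or> p mod 4 = 3" by presburger
      moreover have "odd p \<Longrightarrow> p mod 8 = 1 \<or> p mod 8 = 3 \<or> p mod 8 = 5 \<or> p mod 8 = 7" by presburger
      ultimately show ?thesis using that(1) S(2)
        by (auto simp: \<chi>_def I_def quadratic_character_prime quadratic_character_def[of 4]
            quadratic_character_def[of 8] character_mod_4_def character_mod_8_def)
    qed
    show "real_of_int (\<delta> i) \<in> {-1, 1}" if "i \<in> I" for i using \<epsilon>[of i] by (auto simp: \<delta>_def)
    show "\<exists>C. \<forall>m n. \<bar>\<Sum>k\<in>{m..<n}. \<Prod>i\<in>T. \<chi> i k\<bar> \<le> C" if T: "T \<subseteq> I" "T \<noteq> {}" for T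
    proof -
      obtain i where "i \<in> T" using T by blast
      then obtain c where c: "coprime c M" "quadratic_character i c = -1" "\<forall>j\<in>I - {i}. quadratic_character j c = 1"
        using separating T by blast
      have "finite T" using T S(1) by (auto simp: I_def intro: finite_subset)
      have "\<bar>\<Sum>k\<in>{m..<n}. \<Prod>i\<in>T. \<chi> i k\<bar> \<le> 2 * real M" for m n
      proof (rule character_sum_bounded[OF \<open>M > 0\<close> _ _ _ c(1)])
        show "(\<Prod>i\<in>T. \<chi> i (k + M)) = (\<Prod>i\<in>T. \<chi> i k)" for k
        proof (rule prod.cong[OF refl])
          fix j assume "j \<in> T"
          then have "[k + M = k] (mod j)" using T dvdM by (simp add: cong_add_lcancel_0_nat cong_0_iff subset_iff)
          then show "\<chi> j (k + M) = \<chi> j k" using quadratic_character_mod by (simp add: \<chi>_def)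
        qed
        show "(\<Prod>i\<in>T. \<chi> i (m * n)) = (\<Prod>i\<in>T. \<chi> i m) * (\<Prod>i\<in>T. \<chi> i n)" for m n
          unfolding prod.distrib[symmetric] using T mult by (intro prod.cong) (auto simp: \<chi>_def)
        show "\<bar>\<Prod>i\<in>T. \<chi> i k\<bar> \<le> 1" for k
          unfolding abs_prod
        proof (rule prod_le_1)
          fix i
          show "0 \<le> \<bar>\<chi> i k\<bar> \<and> \<bar>\<chi> i k\<bar> \<le> 1" using vals[of i k] by auto
        qed
        have "(\<Prod>i\<in>T. \<chi> i c) = \<chi> i c * (\<Prod>i\<in>T-{i}. \<chi> i c)"
          using \<open>finite T\<close> \<open>i \<in> T\<close> by (rule prod.remove)
        also have "(\<Prod>i\<in>T-{i}. \<chi> i c) = 1" using c(3) T by (intro prod.neutral) (auto simp: \<chi>_def)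
        finally show "(\<Prod>i\<in>T. \<chi> i c) \<noteq> 1" using c(2) by (simp add: \<chi>_def)
      qed
      then show ?thesis by blast
    qed
  qed
  then obtain q where q: "prime q" "q \<notin> S" "\<And>i. i \<in> I \<Longrightarrow> quadratic_character i q = \<delta> i"
    by (auto simp: \<chi>_def)
  have "character_mod_4 q = 1" "character_mod_8 q = 1"
    using q(3)[of 4] q(3)[of 8] not_prime by (auto simp: I_def \<delta>_def quadratic_character_def)
  then have "q mod 4 = 1" "q mod 8 = 1 \<or> q mod 8 = 7"
    by (auto simp: character_mod_4_def character_mod_8_def split: if_splits)
  then have "q mod 8 = 1" by presburger
  moreover have "Legendre (int q) (int p) = \<epsilon> p" if "p \<in> S" for p
    using q(3)[of p] that S(2) by (simp add: I_def \<delta>_def quadratic_character_prime)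
  ultimately show ?thesis using q by blast
qed

section \<open>Zeros of diagonal ternary forms\<close>

lemma square_root_mod_prime_product:
  fixes c :: int
  assumes "finite S" "\<And>p. p \<in> S \<Longrightarrow> prime p" "\<And>p. p \<in> S \<Longrightarrow> \<exists>y. [y\<^sup>2 = c] (mod int p)"
  shows "\<exists>y. [y\<^sup>2 = c] (mod int (\<Prod>p\<in>S. p))"
  using assms
proof (induction S rule: finite_induct)
  case (insert p S)
  obtain y where y: "[y\<^sup>2 = c] (mod int (\<Prod>p\<in>S. p))" using insert by auto
  obtain z where z: "[z\<^sup>2 = c] (mod int p)" using insert by auto
  have "coprime p (\<Prod>p\<in>S. p)"
    using insert by (intro prod_coprime_right) (auto intro!: primes_coprime)
  then have cop: "coprime (int p) (int (\<Prod>p\<in>S. p))" by (simp only: coprime_int_iff)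
  then obtain x where "[x = z] (mod int p)" "[x = y] (mod int (\<Prod>p\<in>S. p))"
    using binary_chinese_remainder_int by blast
  then have "[x\<^sup>2 = c] (mod int p)" "[x\<^sup>2 = c] (mod int (\<Prod>p\<in>S. p))"
    using y z cong_pow cong_trans by blast+
  then have "[x\<^sup>2 = c] (mod int p * int (\<Prod>p\<in>S. p))" using cop by (rule coprime_cong_mult)
  then show ?case using insert.hyps by auto
qed auto

text \<open>Additivity, stated in the form needed when two points of a box have the same residues
  and are subtracted.\<close>

definition preserves_differences :: "(int \<Rightarrow> int \<Rightarrow> int \<Rightarrow> int) \<Rightarrow> bool" where
  "preserves_differences F \<longleftrightarrow>
     (\<forall>x y z x' y' z'. F (x - x') (y - y') (z - z') = F x y z - F x' y' z')"

text \<open>Pigeonhole: the box has more points than there are triples of residues, and the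
  difference of two colliding points solves the congruences.\<close>

lemma small_solution_linear_congruences:
  fixes f g h :: "int \<Rightarrow> int \<Rightarrow> int \<Rightarrow> int"
  assumes linear: "preserves_differences f" "preserves_differences g" "preserves_differences h"
    and pos: "m1 > 0" "m2 > 0" "m3 > (0::nat)"
    and box: "m1 * m2 * m3 < Suc X * Suc Y * Suc Z"
  shows "\<exists>x y z. (x, y, z) \<noteq> (0, 0, 0) \<and> \<bar>x\<bar> \<le> int X \<and> \<bar>y\<bar> \<le> int Y \<and> \<bar>z\<bar> \<le> int Z
    \<and> int m1 dvd f x y z \<and> int m2 dvd g x y z \<and> int m3 dvd h x y z"
proof -
  define D where "D = {0..int X} \<times> {0..int Y} \<times> {0..int Z}"
  define R where "R = {0..<int m1} \<times> {0..<int m2} \<times> {0..<int m3}"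
  define \<phi> where "\<phi> = (\<lambda>(x, y, z). (f x y z mod int m1, g x y z mod int m2, h x y z mod int m3))"
  have "\<phi> ` D \<subseteq> R" using pos by (auto simp: \<phi>_def R_def)
  then have "card (\<phi> ` D) \<le> card R" by (intro card_mono) (auto simp: R_def)
  also have "\<dots> < card D" using box by (simp add: R_def D_def card_cartesian_product nat_add_distrib algebra_simps)
  finally have "\<not> inj_on \<phi> D" by (rule pigeonhole)
  then obtain x y z x' y' z' where xyz: "(x, y, z) \<in> D" "(x', y', z') \<in> D"
    "\<phi> (x, y, z) = \<phi> (x', y', z')" "(x, y, z) \<noteq> (x', y', z')"
    unfolding inj_on_def by (metis prod_cases3)
  have "int m1 dvd f (x - x') (y - y') (z - z')" "int m2 dvd g (x - x') (y - y') (z - z')"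
    "int m3 dvd h (x - x') (y - y') (z - z')"
    using xyz(3) by (simp_all add: linear[unfolded preserves_differences_def] \<phi>_def mod_eq_dvd_iff)
  moreover have "(x - x', y - y', z - z') \<noteq> (0, 0, 0)" using xyz(4) by auto
  moreover have "\<bar>x - x'\<bar> \<le> int X" "\<bar>y - y'\<bar> \<le> int Y" "\<bar>z - z'\<bar> \<le> int Z"
    using xyz(1,2) by (auto simp: D_def)
  ultimately show ?thesis by blast
qed

text \<open>A form of Legendre's theorem. The box argument gives a vector at which
  \<open>a x\<^sup>2 + b y\<^sup>2 - c z\<^sup>2\<close> is \<open>0\<close> or \<open>abc\<close>; in the latter case \<open>(xz + by, yz - ax, z\<^sup>2 + ab)\<close> is a zero.\<close>

lemma legendre_zero:
  fixes a b c :: nat and f g h :: "int \<Rightarrow> int \<Rightarrow> int \<Rightarrow> int"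
  assumes linear: "preserves_differences f" "preserves_differences g" "preserves_differences h"
    and m: "m1 * m2 * m3 = a * b * c" and pos: "a > 0" "b > 0" "c > 0"
    and nonsquare: "\<nexists>k. k\<^sup>2 = b * c" "\<nexists>k. k\<^sup>2 = a * b"
    and dvd: "\<And>x y z. int m1 dvd f x y z \<Longrightarrow> int m2 dvd g x y z \<Longrightarrow> int m3 dvd h x y z
      \<Longrightarrow> int (a * b * c) dvd int a * x\<^sup>2 + int b * y\<^sup>2 - int c * z\<^sup>2"
  shows "\<exists>x y z :: int. z \<noteq> 0 \<and> int a * x\<^sup>2 + int b * y\<^sup>2 = int c * z\<^sup>2"
proof -
  obtain X where X: "X\<^sup>2 \<le> b * c" "b * c < (Suc X)\<^sup>2" using floor_sqrt_power2_le Suc_floor_sqrt_power2_gt by blast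
  obtain Y where Y: "Y\<^sup>2 \<le> a * c" "a * c < (Suc Y)\<^sup>2" using floor_sqrt_power2_le Suc_floor_sqrt_power2_gt by blast
  obtain Z where Z: "Z\<^sup>2 \<le> a * b" "a * b < (Suc Z)\<^sup>2" using floor_sqrt_power2_le Suc_floor_sqrt_power2_gt by blast
  have "(m1 * m2 * m3)\<^sup>2 = (b * c) * (a * c) * (a * b)"
    unfolding m by (simp add: power2_eq_square mult_ac)
  also have "\<dots> < (Suc X)\<^sup>2 * (Suc Y)\<^sup>2 * (Suc Z)\<^sup>2"
    using X Y Z pos by (intro mult_strict_mono) (auto simp del: power_Suc)
  also have "\<dots> = (Suc X * Suc Y * Suc Z)\<^sup>2" by (simp only: power_mult_distrib)
  finally have box: "m1 * m2 * m3 < Suc X * Suc Y * Suc Z" by (rule power_less_imp_less_base) simp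
  have "m1 > 0" "m2 > 0" "m3 > 0" using m pos by (metis gr0I mult_is_0)+
  from small_solution_linear_congruences[OF linear this box]
  obtain x y z where xyz: "(x, y, z) \<noteq> (0, 0, 0)" "\<bar>x\<bar> \<le> int X" "\<bar>y\<bar> \<le> int Y" "\<bar>z\<bar> \<le> int Z"
    "int m1 dvd f x y z" "int m2 dvd g x y z" "int m3 dvd h x y z" by blast
  define V where "V = int a * x\<^sup>2 + int b * y\<^sup>2 - int c * z\<^sup>2"
  have square_le: "w\<^sup>2 \<le> int n" if "\<bar>w\<bar> \<le> int W" "W\<^sup>2 \<le> n" for w W n
  proof -
    have "w\<^sup>2 \<le> (int W)\<^sup>2" using power_mono[OF that(1), of 2] by simp
    also have "\<dots> \<le> int n" using that(2) by (metis of_nat_le_iff of_nat_power)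
    finally show ?thesis .
  qed
  have not_square: "w\<^sup>2 \<noteq> int n" if "\<nexists>k. k\<^sup>2 = n" for w n
  proof
    assume "w\<^sup>2 = int n"
    then have "int ((nat \<bar>w\<bar>)\<^sup>2) = int n" by simp
    then show False using that by (metis of_nat_eq_iff)
  qed
  \<comment> \<open>The nonsquare hypotheses make these two bounds strict, which places
    \<open>V\<close> strictly between \<open>- abc\<close> and \<open>2abc\<close>; as a multiple of
    \<open>abc\<close> it is 0 or \<open>abc\<close>.\<close>
  have "x\<^sup>2 < int (b * c)" "z\<^sup>2 < int (a * b)"
    using square_le[OF xyz(2) X(1)] square_le[OF xyz(4) Z(1)] not_square[OF nonsquare(1), of x]
      not_square[OF nonsquare(2), of z] by linarith+
  moreover have "y\<^sup>2 \<le> int (a * c)" using square_le[OF xyz(3) Y(1)] .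
  ultimately have "int a * x\<^sup>2 < int a * int (b * c)" "int b * y\<^sup>2 \<le> int b * int (a * c)"
    "int c * z\<^sup>2 < int c * int (a * b)" "0 \<le> int a * x\<^sup>2" "0 \<le> int b * y\<^sup>2" "0 \<le> int c * z\<^sup>2"
    using pos by (auto intro: mult_strict_left_mono mult_left_mono simp del: of_nat_mult)
  moreover have abc: "int a * int (b * c) = int (a * b * c)" "int b * int (a * c) = int (a * b * c)"
    "int c * int (a * b) = int (a * b * c)" by (simp_all add: mult_ac)
  ultimately have "- int (a * b * c) < V" "V < 2 * int (a * b * c)"
    unfolding V_def by (simp_all only: abc)
  moreover obtain k where k: "V = int (a * b * c) * k" using dvd[OF xyz(5-7)] unfolding V_def by blast
  ultimately have "int (a * b * c) * (-1) < int (a * b * c) * k" "int (a * b * c) * k < int (a * b * c) * 2"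
    by linarith+
  then have "-1 < k" "k < 2" by (metis mult_less_cancel_left of_nat_0_le_iff not_less)+
  then have "k = 0 \<or> k = 1" by linarith
  then show ?thesis
  proof
    assume "k = 0"
    then have eq: "int a * x\<^sup>2 + int b * y\<^sup>2 = int c * z\<^sup>2" using k V_def by simp
    moreover have "z \<noteq> 0"
    proof
      assume "z = 0"
      then have "int a * x\<^sup>2 + int b * y\<^sup>2 = 0" using eq by simp
      then have "int a * x\<^sup>2 = 0" "int b * y\<^sup>2 = 0"
        using add_nonneg_eq_0_iff[of "int a * x\<^sup>2" "int b * y\<^sup>2"] by simp_all
      then show False using pos xyz(1) \<open>z = 0\<close> by simp
    qed
    ultimately show ?thesis by blast
  next
    assume "k = 1"
    then have *: "int a * x\<^sup>2 + int b * y\<^sup>2 = int c * (z\<^sup>2 + int a * int b)"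
      using k V_def by (simp add: algebra_simps)
    have "int a * (x * z + int b * y)\<^sup>2 + int b * (y * z - int a * x)\<^sup>2
        = (int a * x\<^sup>2 + int b * y\<^sup>2) * (z\<^sup>2 + int a * int b)"
      by (simp add: power2_eq_square algebra_simps)
    also have "\<dots> = int c * (z\<^sup>2 + int a * int b)\<^sup>2" unfolding * by (simp add: power2_eq_square)
    finally have "int a * (x * z + int b * y)\<^sup>2 + int b * (y * z - int a * x)\<^sup>2 = int c * (z\<^sup>2 + int a * int b)\<^sup>2" .
    moreover have "0 < int a * int b" using pos by simp
    then have "z\<^sup>2 + int a * int b \<noteq> 0" using zero_le_power2[of z] by linarith
    ultimately show ?thesis by blast
  qed
qed

text \<open>Thue's argument: the box degenerates to two variables and yields
  \<open>x^2 + 2 * y^2 = q * k\<close> with \<open>0 < k < 3\<close>. If \<open>k = 2\<close>, then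
  \<open>x\<close> is even, and halving the equation exchanges the two squares.\<close>

lemma prime_eq_square_plus_2_square:
  assumes "prime q" "[s\<^sup>2 = -2] (mod int q)" "odd q"
  shows "\<exists>y z :: int. int q = y\<^sup>2 + 2 * z\<^sup>2"
proof -
  obtain W where W: "W\<^sup>2 \<le> q" "q < (Suc W)\<^sup>2" using floor_sqrt_power2_le Suc_floor_sqrt_power2_gt by blast
  have "q > 0" using assms(1) prime_gt_0_nat by blast
  have box: "q * 1 * 1 < Suc W * Suc W * Suc 0" using W by (simp add: power2_eq_square)
  have "\<exists>x y z. (x, y, z) \<noteq> (0, 0, 0) \<and> \<bar>x\<bar> \<le> int W \<and> \<bar>y\<bar> \<le> int W \<and> \<bar>z\<bar> \<le> int 0
      \<and> int q dvd x - s * y \<and> int 1 dvd x \<and> int 1 dvd x"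
    by (rule small_solution_linear_congruences[of "\<lambda>x y z. x - s * y" "\<lambda>x y z. x" "\<lambda>x y z. x"])
      (use box \<open>q > 0\<close> in \<open>auto simp: preserves_differences_def algebra_simps\<close>)
  then obtain x y z where xyz: "(x, y, z) \<noteq> (0, 0, 0)" "\<bar>x\<bar> \<le> int W" "\<bar>y\<bar> \<le> int W" "\<bar>z\<bar> \<le> int 0"
    "int q dvd x - s * y" by blast
  have "W\<^sup>2 \<noteq> q"
    using assms(1) prime_power_iff[of W 2] by auto
  have less: "w\<^sup>2 < int q" if "\<bar>w\<bar> \<le> int W" for w
  proof -
    have "w\<^sup>2 \<le> (int W)\<^sup>2" using power_mono[OF that, of 2] by simp
    also have "\<dots> < int q" using W(1) \<open>W\<^sup>2 \<noteq> q\<close> by (metis le_neq_implies_less of_nat_less_iff of_nat_power)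
    finally show ?thesis .
  qed
  have "int q dvd (x - s * y) * (x + s * y)" using xyz(5) by simp
  moreover have "int q dvd (s\<^sup>2 - (-2)) * y\<^sup>2" using assms(2) by (simp add: cong_iff_dvd_diff)
  ultimately have "int q dvd (x - s * y) * (x + s * y) + (s\<^sup>2 - (-2)) * y\<^sup>2" by (rule dvd_add)
  also have "\<dots> = x\<^sup>2 + 2 * y\<^sup>2" by (simp add: power2_eq_square algebra_simps)
  finally obtain k where k: "x\<^sup>2 + 2 * y\<^sup>2 = int q * k" by blast
  have "0 < x\<^sup>2 + 2 * y\<^sup>2"
  proof -
    have "x \<noteq> 0 \<or> y \<noteq> 0" using xyz(1,4) by auto
    then have "0 < x\<^sup>2 \<or> 0 < y\<^sup>2" by auto
    then show ?thesis using zero_le_power2[of x] zero_le_power2[of y] by linarith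
  qed
  then have "0 < k" using k \<open>q > 0\<close> by (simp add: zero_less_mult_iff)
  have "int q * k < int q * 3" using less[OF xyz(2)] less[OF xyz(3)] k by linarith
  then have "k < 3" using \<open>q > 0\<close> by simp
  then have "k = 1 \<or> k = 2" using \<open>0 < k\<close> by linarith
  then show ?thesis
  proof
    assume "k = 1"
    then show ?thesis using k by (metis mult.right_neutral)
  next
    assume "k = 2"
    then have eq: "x\<^sup>2 + 2 * y\<^sup>2 = 2 * int q" using k by simp
    then have "even (x\<^sup>2)" by (metis dvd_add_left_iff dvd_triv_left)
    then have "even x" by simp
    then obtain x' where "x = 2 * x'" by blast
    then have "int q = y\<^sup>2 + 2 * x'\<^sup>2" using eq by (simp add: power2_eq_square)
    then show ?thesis by blast
  qed
qed

section \<open>The ternary form\<close>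

definition ternary_form :: "'a::comm_ring_1 \<Rightarrow> 'a \<Rightarrow> 'a \<Rightarrow> 'a" where
  "ternary_form u v t = 2 * (u\<^sup>2 + v\<^sup>2 + t\<^sup>2) - u * v - v * t - t * u"

definition ternary_polar :: "'a::comm_ring_1 \<Rightarrow> 'a \<Rightarrow> 'a \<Rightarrow> 'a \<Rightarrow> 'a \<Rightarrow> 'a \<Rightarrow> 'a" where
  "ternary_polar u v t u' v' t'
     = 4 * (u * u' + v * v' + t * t') - (u * v' + v * u') - (v * t' + t * v') - (t * u' + u * t')"

lemma ternary_form_lincomb:
  "ternary_form (a * u + b * u') (a * v + b * v') (a * t + b * t')
     = a\<^sup>2 * ternary_form u v t + a * b * ternary_polar u v t u' v' t' + b\<^sup>2 * ternary_form u' v' t'"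
  unfolding ternary_form_def ternary_polar_def by (simp add: power2_eq_square algebra_simps)

lemma ternary_form_eq_sum_squares:
  fixes u v t :: "'a::linordered_field"
  shows "ternary_form u v t = ((u - v)\<^sup>2 + (v - t)\<^sup>2 + (t - u)\<^sup>2) / 2 + u\<^sup>2 + v\<^sup>2 + t\<^sup>2"
  unfolding ternary_form_def by (simp add: power2_eq_square field_simps)

lemma ternary_form_nonneg: "0 \<le> ternary_form u v (t::'a::linordered_field)"
  unfolding ternary_form_eq_sum_squares by (intro add_nonneg_nonneg divide_nonneg_pos) auto

lemma ternary_form_eq_0D:
  fixes u v t :: "'a::linordered_field"
  assumes "ternary_form u v t = 0"
  shows "u = 0" "v = 0" "t = 0"
proof -
  have "0 \<le> ((u - v)\<^sup>2 + (v - t)\<^sup>2 + (t - u)\<^sup>2) / 2" "0 \<le> u\<^sup>2" "0 \<le> v\<^sup>2" "0 \<le> t\<^sup>2"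
    by (auto intro!: divide_nonneg_pos add_nonneg_nonneg)
  then have "u\<^sup>2 = 0" "v\<^sup>2 = 0" "t\<^sup>2 = 0"
    using assms unfolding ternary_form_eq_sum_squares by linarith+
  then show "u = 0" "v = 0" "t = 0" by auto
qed

text \<open>In the simplex \<open>1 \<ge> u \<ge> v \<ge> t \<ge> 0\<close> the average of the form over the four differences to
  the vertices, with barycentric weights, is \<open>2u + v\<close> minus the form at \<open>(u, v, t)\<close>. It is at most the squared
  circumradius \<open>19/20\<close>; the circumcentre is \<open>(7/10, 1/2, 3/10)\<close>.\<close>

lemma covering_ordered:
  fixes u v t :: real
  assumes "0 \<le> t" "t \<le> v" "v \<le> u" "u \<le> 1"
  shows "ternary_form u v t < 1 \<or> ternary_form (u - 1) v t < 1
    \<or> ternary_form (u - 1) (v - 1) t < 1 \<or> ternary_form (u - 1) (v - 1) (t - 1) < 1"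
proof (rule ccontr)
  assume "\<not> ?thesis"
  then have "1 \<le> ternary_form u v t" "1 \<le> ternary_form (u - 1) v t"
    "1 \<le> ternary_form (u - 1) (v - 1) t" "1 \<le> ternary_form (u - 1) (v - 1) (t - 1)" by auto
  then have bounds: "(1 - u) * 1 \<le> (1 - u) * ternary_form u v t"
    "(u - v) * 1 \<le> (u - v) * ternary_form (u - 1) v t"
    "(v - t) * 1 \<le> (v - t) * ternary_form (u - 1) (v - 1) t"
    "t * 1 \<le> t * ternary_form (u - 1) (v - 1) (t - 1)"
    using assms by (intro mult_left_mono; simp)+
  have average: "(1 - u) * ternary_form u v t + (u - v) * ternary_form (u - 1) v t
      + (v - t) * ternary_form (u - 1) (v - 1) t + t * ternary_form (u - 1) (v - 1) (t - 1)
      = 19/20 - ternary_form (u - 7/10) (v - 1/2) (t - 3/10)"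
    unfolding ternary_form_def by (simp add: power2_eq_square field_simps)
  have "(1 - u) * 1 + (u - v) * 1 + (v - t) * 1 + t * 1
      \<le> 19/20 - ternary_form (u - 7/10) (v - 1/2) (t - 3/10)"
    unfolding average[symmetric] using bounds by (intro add_mono)
  then show False using ternary_form_nonneg[of "u - 7/10" "v - 1/2" "t - 3/10"] by simp
qed

lemma ternary_form_perm: "ternary_form u v t = ternary_form v u t" "ternary_form u v t = ternary_form u t v"
  unfolding ternary_form_def by (simp_all add: algebra_simps)

text \<open>The six orderings of the coordinates cut the cube into simplices, which the symmetry of
  the form carries to the ordered one.\<close>

lemma covering_unit_cube:
  fixes u v t :: real
  assumes "0 \<le> u" "u \<le> 1" "0 \<le> v" "v \<le> 1" "0 \<le> t" "t \<le> 1"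
  shows "\<exists>i j k :: int. ternary_form (u - of_int i) (v - of_int j) (t - of_int k) < 1"
proof -
  let ?P = "\<lambda>u v t. \<exists>i j k :: int. ternary_form (u - of_int i) (v - of_int j) (t - of_int k) < (1::real)"
  have ordered: "?P u v t" if "0 \<le> t" "t \<le> v" "v \<le> u" "u \<le> 1" for u v t :: real
    using covering_ordered[OF that] by (metis diff_zero of_int_0 of_int_1)
  have swap: "?P u v t \<Longrightarrow> ?P v u t" "?P u v t \<Longrightarrow> ?P u t v" for u v t :: real
    using ternary_form_perm by metis+
  consider "t \<le> v" "v \<le> u" | "t \<le> u" "u \<le> v" | "v \<le> t" "t \<le> u" | "v \<le> u" "u \<le> t"
    | "u \<le> t" "t \<le> v" | "u \<le> v" "v \<le> t" by linarith
  then show ?thesis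
  proof cases
    case 1 then show ?thesis using assms by (intro ordered)
  next
    case 2 then show ?thesis using assms by (intro swap(1)[OF ordered])
  next
    case 3 then show ?thesis using assms by (intro swap(2)[OF ordered])
  next
    case 4 then show ?thesis using assms by (intro swap(2)[OF swap(1)[OF ordered]])
  next
    case 5 then show ?thesis using assms by (intro swap(1)[OF swap(2)[OF ordered]])
  next
    case 6 then show ?thesis using assms by (intro swap(1)[OF swap(2)[OF swap(1)[OF ordered]]])
  qed
qed

lemma covering:
  fixes u v t T :: int
  assumes "T > 0"
  shows "\<exists>u' v' t'. ternary_form (u - T * u') (v - T * v') (t - T * t') < T\<^sup>2"
proof -
  have "frac x \<le> 1" for x :: real using frac_lt_1[of x] by linarith
  then obtain i j k :: int where ijk: "ternary_form (frac (u / T) - of_int i) (frac (v / T) - of_int j) (frac (t / T) - of_int k) < (1::real)"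
    using covering_unit_cube[OF frac_ge_0 _ frac_ge_0 _ frac_ge_0] by blast
  let ?u = "\<lfloor>u / T\<rfloor> + i" and ?v = "\<lfloor>v / T\<rfloor> + j" and ?t = "\<lfloor>t / T\<rfloor> + k"
  have "real_of_int (ternary_form (u - T * ?u) (v - T * ?v) (t - T * ?t))
      = (real_of_int T)\<^sup>2 * ternary_form (frac (u / T) - of_int i) (frac (v / T) - of_int j) (frac (t / T) - of_int k)"
  proof -
    have eq: "real_of_int (x - T * (\<lfloor>x / T\<rfloor> + m)) = T * (frac (x / T) - m)" for x m
      using assms by (simp add: frac_def field_simps)
    have hom: "ternary_form (c * x) (c * y) (c * z) = c\<^sup>2 * ternary_form x y z" for c x y z :: real
      unfolding ternary_form_def by (simp add: power2_eq_square algebra_simps)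
    have "real_of_int (ternary_form x y z) = ternary_form (real_of_int x) (real_of_int y) (real_of_int z)" for x y z
      by (simp add: ternary_form_def)
    then show ?thesis by (simp only: eq hom)
  qed
  also have "\<dots> < (real_of_int T)\<^sup>2 * 1"
    using ijk assms by (intro mult_strict_left_mono) auto
  finally have "ternary_form (u - T * ?u) (v - T * ?v) (t - T * ?t) < T\<^sup>2"
    by (metis mult.right_neutral of_int_less_iff of_int_power)
  then show ?thesis by blast
qed

text \<open>The Davenport--Cassels descent: intersect the line through a rational point and a nearby
  lattice point a second time with the quadric.\<close>

theorem ternary_form_integral_of_rational:
  fixes N T :: int
  assumes "T > 0" "ternary_form u v t = N * T\<^sup>2"
  shows "\<exists>u v t :: int. ternary_form u v t = N"
  using assms
proof (induction "nat T" arbitrary: T u v t rule: less_induct)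
  case less
  obtain u' v' t' where w: "ternary_form (u - T * u') (v - T * v') (t - T * t') < T\<^sup>2"
    using covering[OF less.prems(1)] by blast
  \<comment> \<open>With these choices the form at the difference is \<open>T * (T * A + B)\<close>,
    so \<open>T * A + B\<close> lies in \<open>{0..<T}\<close> and becomes the next
    denominator.\<close>
  define A where "A = ternary_form u' v' t' - N"
  define B where "B = 2 * N * T - ternary_polar u v t u' v' t'"
  have form: "ternary_form (u - T * u') (v - T * v') (t - T * t') = T * (T * A + B)"
    using ternary_form_lincomb[of 1 u "-T" u' v v' t t'] less.prems(2)
    by (simp add: A_def B_def algebra_simps power2_eq_square)
  have nonneg: "0 \<le> ternary_form x y z" for x y z :: int
  proof -
    have "real_of_int (ternary_form x y z) = ternary_form (real_of_int x) (real_of_int y) (real_of_int z)"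
      by (simp add: ternary_form_def)
    then show ?thesis using ternary_form_nonneg by (metis of_int_0_le_iff)
  qed
  show ?case
  proof (cases "T * A + B = 0")
    \<comment> \<open>Here the nearby lattice point coincides with the rational point.\<close>
    case True
    have "ternary_form (real_of_int (u - T * u')) (real_of_int (v - T * v')) (real_of_int (t - T * t'))
        = real_of_int (ternary_form (u - T * u') (v - T * v') (t - T * t'))"
      by (simp add: ternary_form_def)
    also have "\<dots> = 0" by (simp only: form True)
    finally have "u - T * u' = 0" "v - T * v' = 0" "t - T * t' = 0"
      using ternary_form_eq_0D by (metis of_int_eq_0_iff)+
    then have "u = T * u'" "v = T * v'" "t = T * t'" by auto
    then have "ternary_form u v t = T\<^sup>2 * ternary_form u' v' t'"
      by (simp add: ternary_form_def algebra_simps power2_eq_square)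
    then have "ternary_form u' v' t' = N" using less.prems by simp
    then show ?thesis by blast
  next
    case False
    have "0 \<le> T * (T * A + B)" using nonneg[of "u - T * u'" "v - T * v'" "t - T * t'"] form by simp
    then have pos: "0 < T * A + B" using False less.prems(1) by (simp add: zero_le_mult_iff)
    have "T * (T * A + B) < T * T" using w form by (simp add: power2_eq_square)
    then have small: "T * A + B < T" using less.prems(1) by simp
    \<comment> \<open>These are the numerators of the second intersection point over the denominator
      \<open>T * A + B\<close>.\<close>
    have "ternary_form (A * u + B * u') (A * v + B * v') (A * t + B * t')
        = A\<^sup>2 * (N * T\<^sup>2) + A * B * (2 * N * T - B) + B\<^sup>2 * (A + N)"
      by (simp add: ternary_form_lincomb less.prems(2) A_def B_def)
    also have "\<dots> = N * (T * A + B)\<^sup>2" by (simp add: power2_eq_square algebra_simps)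
    finally show ?thesis
      using less.hyps[of "T * A + B"] pos small by auto
  qed
qed

section \<open>Values of the ternary form in the required residue classes\<close>

lemma square_neq_prime_mult:
  fixes q m k :: nat
  assumes "prime q" "\<not> q dvd m"
  shows "k\<^sup>2 \<noteq> q * m"
proof
  assume eq: "k\<^sup>2 = q * m"
  then have "q dvd k" using assms(1) by (metis dvd_triv_left prime_dvd_power)
  then obtain l where "k = q * l" by blast
  then have "m = q * l\<^sup>2" using eq assms(1) by (simp add: power2_eq_square prime_gt_0_nat mult_ac)
  then show False using assms(2) by simp
qed

lemma Legendre_5_reciprocity:
  assumes "prime p" "2 < p" "p \<noteq> 5"
  shows "Legendre 5 (int p) = Legendre (int p) 5"
proof -
  have "prime (5::nat)" by simp
  have "\<not> int p dvd 5" using primes_dvd_imp_eq[OF assms(1) \<open>prime (5::nat)\<close>] assms(3)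
    by (metis int_dvd_int_iff of_nat_numeral)
  moreover have "\<not> 5 dvd int p" using primes_dvd_imp_eq[OF \<open>prime (5::nat)\<close> assms(1)] assms(3)
    by (metis int_dvd_int_iff of_nat_numeral)
  ultimately have "Legendre 5 (int p) \<in> {-1, 1}" "Legendre (int p) 5 \<in> {-1, 1}"
    using Legendre_range[of 5 "int p"] Legendre_range[of "int p" 5] Legendre_neq_0_iff by auto
  moreover have "Legendre (int p) (int 5) * Legendre (int 5) (int p) = 1"
    using Quadratic_Reciprocity[OF assms(1,2) \<open>prime (5::nat)\<close> _ assms(3)] by (simp add: minus_one_power_iff)
  ultimately show ?thesis by auto
qed

lemma Legendre_mod_5_nonresidue:
  assumes "N mod 5 \<in> {2, 3 :: nat}"
  shows "Legendre (int N) 5 = -1"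
proof -
  have "\<not> [y\<^sup>2 = int N] (mod 5)" for y
  proof -
    have "int N mod 5 \<in> {2, 3}" using assms zmod_int[of N 5] by auto
    moreover have "y mod 5 \<in> {0, 1, 2, 3, 4}" by (simp; presburger)
    then have "(y mod 5)\<^sup>2 mod 5 \<in> {0, 1, 4}" by auto
    then have "y\<^sup>2 mod 5 \<in> {0, 1, 4}" by (simp add: power_mod)
    ultimately show ?thesis by (auto simp: cong_def)
  qed
  moreover have "\<not> 5 dvd int N" using assms zmod_int[of N 5] by (auto simp: dvd_eq_mod_eq_0)
  ultimately show ?thesis by (auto simp: Legendre_def QuadRes_def cong_0_iff)
qed

lemma squarefree_eq_prod_prime_factors:
  fixes N :: nat
  assumes "squarefree N"
  shows "N = (\<Prod>p\<in>prime_factors N. p)"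
proof -
  have "N \<noteq> 0" using assms by (metis not_squarefree_0)
  then have "(\<Prod>p\<in>prime_factors N. p ^ multiplicity p N) = N" by (simp add: prime_factorization_nat[symmetric])
  moreover have "multiplicity p N = 1" if "p \<in> prime_factors N" for p
  proof -
    have "multiplicity p N \<le> 1" using assms \<open>N \<noteq> 0\<close> that in_prime_factors_imp_prime
      by (auto simp: squarefree_factorial_semiring'')
    moreover have "0 < multiplicity p N" using that by (simp add: prime_factors_multiplicity)
    ultimately show ?thesis by simp
  qed
  ultimately show ?thesis by simp
qed

text \<open>For \<open>m = 2 * k + 1\<close> the number \<open>k + 1\<close> is inverse to 2, so
  \<open>x\<close> is \<open>y / 2\<close> and \<open>2 * x^2\<close> is \<open>y^2 / 2\<close>,
  that is \<open>c\<close>, modulo \<open>m\<close>.\<close>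

lemma halve_square_root_mod:
  fixes m c :: int
  assumes "odd m" "[y\<^sup>2 = 2 * c] (mod m)"
  shows "\<exists>x. m dvd 2 * x\<^sup>2 - c"
proof -
  obtain k where k: "m = 2 * k + 1" using assms(1) by (elim oddE)
  define x where "x = y * (k + 1)"
  have "2 * x = y + m * y" by (simp add: x_def k algebra_simps)
  have "2 * (2 * x\<^sup>2 - c) = (2 * x)\<^sup>2 - 2 * c" by (simp add: power2_eq_square)
  also have "\<dots> = (y\<^sup>2 - 2 * c) + m * (2 * y\<^sup>2 + m * y\<^sup>2)"
    unfolding \<open>2 * x = y + m * y\<close> by (simp add: power2_eq_square algebra_simps)
  finally have "2 * (2 * x\<^sup>2 - c) = \<dots>" .
  moreover have "m dvd y\<^sup>2 - 2 * c" using assms(2) by (simp add: cong_iff_dvd_diff)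
  ultimately have "m dvd 2 * (2 * x\<^sup>2 - c)" by (simp only: dvd_add dvd_triv_left)
  moreover have "coprime m 2" using assms(1) by simp
  ultimately show ?thesis using coprime_dvd_mult_right_iff by blast
qed

text \<open>The equation \<open>2 * x^2 + 5 * q * y^2 = N * z^2\<close> requires
  \<open>2 * N\<close> to be a square modulo 5 and modulo \<open>q\<close>, and
  \<open>-10 * q\<close> to be one modulo \<open>N\<close>. The last holds by the choice of
  \<open>q\<close>; reciprocity and the residues of \<open>N\<close> give the others. Writing
  \<open>q\<close> as \<open>Y^2 + 2 * Z^2\<close> then splits the middle term.\<close>

lemma rational_representation_squarefree:
  fixes N :: nat
  assumes "squarefree N" "N mod 8 = 5" "N mod 5 \<in> {2, 3}"
  shows "\<exists>X Y Z T :: int. T \<noteq> 0 \<and> int N * T\<^sup>2 = 2 * X\<^sup>2 + 5 * Y\<^sup>2 + 10 * Z\<^sup>2"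
proof -
  define S where "S = prime_factors N"
  have N: "N = (\<Prod>p\<in>S. p)" unfolding S_def using assms(1) by (rule squarefree_eq_prod_prime_factors)
  have "odd N" using assms(2) by presburger
  have "\<not> 5 dvd N" using assms(3) by (auto simp: dvd_eq_mod_eq_0)
  have finS: "finite S" by (simp add: S_def)
  have S: "prime p \<and> 2 < p \<and> p \<noteq> 5" if "p \<in> S" for p
  proof -
    have p: "prime p" "p dvd N" using that by (auto simp: S_def)
    then have "odd p" "p \<noteq> 5" using \<open>odd N\<close> \<open>\<not> 5 dvd N\<close> by auto
    then have "p \<noteq> 2" by auto
    then show ?thesis using p(1) \<open>p \<noteq> 5\<close> prime_ge_2_nat[OF p(1)] by linarith
  qed
  have S10: "\<not> int p dvd 10" if "p \<in> S" for p
  proof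
    assume "int p dvd 10"
    then have "p dvd 10" by (metis int_dvd_int_iff of_nat_numeral)
    then have "p dvd 2 * 5" by simp
    then have "p dvd 2 \<or> p dvd 5" using S[OF that] by (simp only: prime_dvd_mult_iff)
    then show False using S[OF that] primes_dvd_imp_eq[of p 2] primes_dvd_imp_eq[of p 5] by auto
  qed
  have "Legendre (-10) (int p) \<in> {-1, 1}" if "p \<in> S" for p
    using S10[OF that] Legendre_range[of "-10" "int p"] Legendre_neq_0_iff[of "-10" "int p"] by auto
  then obtain q where q: "prime q" "q \<notin> S" "q mod 8 = 1"
    "\<And>p. p \<in> S \<Longrightarrow> Legendre (int q) (int p) = Legendre (-10) (int p)"
    using exists_prime_with_residue_symbols[OF finS, of "\<lambda>p. Legendre (-10) (int p)"] S by blast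
  have "odd q" using q(3) by presburger
  then have "2 < q" using prime_ge_2_nat[OF q(1)] by (cases "q = 2") auto
  have "q \<noteq> 5" using q(3) by auto
  have "\<not> q dvd N" using q(1,2) \<open>odd N\<close> by (cases "N = 0") (auto simp: S_def prime_factors_dvd)
  have q5: "coprime (5::nat) q" using q(1) \<open>q \<noteq> 5\<close> by (intro primes_coprime) auto
  have half_even: "even ((q - 1) div 2)" using q(3) by presburger
  have chars_q: "character_mod_4 q = 1" "character_mod_8 q = 1"
  proof -
    have "q mod 4 = 1" using q(3) by presburger
    then show "character_mod_4 q = 1" "character_mod_8 q = 1" using q(3)
      by (auto simp: character_mod_4_def character_mod_8_def)
  qed
  have minus_2: "Legendre (-2) (int q) = 1"
    using Legendre_minus_2[OF q(1) \<open>2 < q\<close>] chars_q by simp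
  then have two: "Legendre 2 (int q) = 1"
    using Legendre_mult[OF q(1) \<open>2 < q\<close>, of "-1" "-2"] Legendre_minus_1[OF q(1) \<open>2 < q\<close>] half_even by simp

  have swap: "Legendre (int p) (int q) = Legendre (int q) (int p)" if "p \<in> S" for p
  proof -
    have "p \<noteq> q" using that q(2) by auto
    then have "Legendre (int p) (int q) * Legendre (int q) (int p) = 1"
      using Quadratic_Reciprocity[of p q] S[OF that] q(1) \<open>2 < q\<close> half_even by simp
    then show ?thesis
      using Legendre_range[of "int p" "int q"] Legendre_range[of "int q" "int p"] by auto
  qed
  \<comment> \<open>Reciprocity gives (p/q) = (q/p) since \<open>q\<close> is 1 modulo 8, and the
    choice of \<open>q\<close> makes this (-10/p) = (-2/p)(5/p).\<close>
  have symbol: "Legendre (int p) (int q) = character_mod_4 p * character_mod_8 p * Legendre (int p) 5"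
    if "p \<in> S" for p
    using Legendre_mult[of p "-2" 5] Legendre_minus_2[of p] Legendre_5_reciprocity[of p] S[OF that]
      swap[OF that] q(4)[OF that] by simp
  have "Legendre (int N) (int q) = (\<Prod>p\<in>S. Legendre (int p) (int q))"
    unfolding N of_nat_prod by (rule Legendre_prod[OF q(1) \<open>2 < q\<close>])
  also have "\<dots> = (\<Prod>p\<in>S. character_mod_4 p) * (\<Prod>p\<in>S. character_mod_8 p) * (\<Prod>p\<in>S. Legendre (int p) 5)"
    unfolding prod.distrib[symmetric] by (intro prod.cong refl symbol)
  also have "(\<Prod>p\<in>S. character_mod_4 p) = character_mod_4 N"
    unfolding N using finS by (induction S rule: finite_induct) (auto simp: character_mod_4_mult, simp add: character_mod_4_def)
  also have "(\<Prod>p\<in>S. character_mod_8 p) = character_mod_8 N"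
    unfolding N using finS by (induction S rule: finite_induct) (auto simp: character_mod_8_mult, simp add: character_mod_8_def)
  also have "(\<Prod>p\<in>S. Legendre (int p) 5) = Legendre (int N) 5"
    unfolding N of_nat_prod using Legendre_prod[of 5 int S] by simp
  \<comment> \<open>The three factors are 1, -1 and -1: the conditions modulo 8 and modulo 5 cancel
    each other.\<close>
  also have "character_mod_4 N * character_mod_8 N * Legendre (int N) 5 = 1"
  proof -
    have "N mod 4 = 1" using assms(2) by presburger
    then show ?thesis using assms(2) Legendre_mod_5_nonresidue[OF assms(3)]
      by (simp add: character_mod_4_def character_mod_8_def)
  qed
  finally have "Legendre (2 * int N) (int q) = 1"
    using Legendre_mult[OF q(1) \<open>2 < q\<close>, of 2 "int N"] two by simp
  then obtain y1 where y1: "[y1\<^sup>2 = 2 * int N] (mod int q)" using Legendre_eq_1_imp_square by blast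
  obtain y2 where y2: "[y2\<^sup>2 = 2 * int N] (mod 5)"
  proof -
    have "int N mod 5 \<in> {2, 3}" using assms(3) zmod_int[of N 5] by auto
    moreover have "2 * int N mod 5 = 2 * (int N mod 5) mod 5" by (simp add: mod_mult_right_eq)
    ultimately have "[2\<^sup>2 = 2 * int N] (mod 5) \<or> [1\<^sup>2 = 2 * int N] (mod 5)"
      by (auto simp: cong_def)
    then show ?thesis using that by blast
  qed
  have cop: "coprime (5::int) (int q)" using q5 by (metis coprime_int_iff of_nat_numeral)
  then obtain y where "[y = y2] (mod 5)" "[y = y1] (mod int q)" using binary_chinese_remainder_int by blast
  then have "[y\<^sup>2 = 2 * int N] (mod 5)" "[y\<^sup>2 = 2 * int N] (mod int q)"
    using y1 y2 cong_pow cong_trans by blast+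
  then have "[y\<^sup>2 = 2 * int N] (mod 5 * int q)" using cop by (rule coprime_cong_mult)
  then obtain \<alpha> where \<alpha>: "5 * int q dvd 2 * \<alpha>\<^sup>2 - int N"
    using halve_square_root_mod[of "5 * int q"] \<open>odd q\<close> by auto
  have "\<exists>y. [y\<^sup>2 = 2 * (- 5 * int q)] (mod int p)" if "p \<in> S" for p
  proof -
    have "Legendre (-10 * int q) (int p) = Legendre (-10) (int p) * Legendre (-10) (int p)"
      using Legendre_mult[of p "-10" "int q"] S[OF that] q(4)[OF that] by simp
    also have "\<dots> = 1" using S10[OF that] Legendre_range[of "-10" "int p"] Legendre_neq_0_iff[of "-10" "int p"] by auto
    finally show ?thesis using Legendre_eq_1_imp_square[of "-10 * int q" "int p"] by simp
  qed
  then have "\<exists>y. [y\<^sup>2 = 2 * (- 5 * int q)] (mod int N)"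
    unfolding N using S by (intro square_root_mod_prime_product[OF finS]) auto
  then obtain \<gamma> where \<gamma>: "int N dvd 2 * \<gamma>\<^sup>2 + 5 * int q"
    using halve_square_root_mod[of "int N" _ "- 5 * int q"] \<open>odd N\<close> by auto
  have "\<exists>x y z :: int. z \<noteq> 0 \<and> int 2 * x\<^sup>2 + int (5 * q) * y\<^sup>2 = int N * z\<^sup>2"
  proof (rule legendre_zero)
    \<comment> \<open>The congruences are taken modulo 2, \<open>5 * q\<close> and \<open>N\<close>.
      Modulo 2 it suffices that \<open>y\<close> and \<open>z\<close> agree, because
      \<open>5 * q\<close> and \<open>N\<close> are odd.\<close>
    show "preserves_differences (\<lambda>x y z. y - z)" "preserves_differences (\<lambda>x y z. x - \<alpha> * z)"
      "preserves_differences (\<lambda>x y z. x - \<gamma> * y)"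
      by (auto simp: preserves_differences_def algebra_simps)
    show "2 * (5 * q) * N = 2 * (5 * q) * N" ..
    show "0 < (2::nat)" "0 < 5 * q" "0 < N" using \<open>2 < q\<close> \<open>odd N\<close> by (auto intro: Nat.gr0I)
    \<comment> \<open>Hence \<open>q\<close> divides \<open>5 * q * N\<close> and
      \<open>10 * q\<close> exactly once, and neither is a square.\<close>
    have "\<not> q dvd 5 * N" "\<not> q dvd 10"
    proof -
      have "\<not> q dvd 5" "\<not> q dvd 2" using q(1) \<open>q \<noteq> 5\<close> \<open>2 < q\<close> primes_dvd_imp_eq[of q 5] primes_dvd_imp_eq[of q 2] by auto
      then have "\<not> q dvd 5 * N" "\<not> q dvd 2 * 5" using q(1) \<open>\<not> q dvd N\<close> prime_dvd_mult_iff by blast+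
      then show "\<not> q dvd 5 * N" "\<not> q dvd 10" by simp_all
    qed
    then show "\<nexists>k. k\<^sup>2 = 5 * q * N" "\<nexists>k. k\<^sup>2 = 2 * (5 * q)"
      using square_neq_prime_mult[OF q(1), of "5 * N"] square_neq_prime_mult[OF q(1), of 10]
      by (simp_all add: mult_ac)
    fix x y z :: int
    assume *: "int 2 dvd y - z" "int (5 * q) dvd x - \<alpha> * z" "int N dvd x - \<gamma> * y"
    let ?V = "int 2 * x\<^sup>2 + int (5 * q) * y\<^sup>2 - int N * z\<^sup>2"
    have "int 2 dvd ?V" using *(1) \<open>odd N\<close> \<open>odd q\<close> by auto
    moreover have "int (5 * q) dvd ?V"
    proof -
      have "?V = 2 * ((x - \<alpha> * z) * (x + \<alpha> * z)) + (2 * \<alpha>\<^sup>2 - int N) * z\<^sup>2 + int (5 * q) * y\<^sup>2"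
        by (simp add: power2_eq_square algebra_simps)
      also have "int (5 * q) dvd \<dots>"
        by (intro dvd_add dvd_mult[OF dvd_mult2[OF *(2)]]) (use \<alpha> in \<open>auto intro: dvd_mult2\<close>)
      finally show ?thesis .
    qed
    moreover have "int N dvd ?V"
    proof -
      have "?V = 2 * ((x - \<gamma> * y) * (x + \<gamma> * y)) + (2 * \<gamma>\<^sup>2 + 5 * int q) * y\<^sup>2 - int N * z\<^sup>2"
        by (simp add: power2_eq_square algebra_simps)
      also have "int N dvd \<dots>"
        by (intro dvd_add dvd_diff dvd_mult[OF dvd_mult2[OF *(3)]] dvd_mult2[OF \<gamma>]) simp
      finally show ?thesis .
    qed
    moreover have "coprime (int 2) (int (5 * q))" "coprime (int (2 * (5 * q))) (int N)"
    proof -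
      have "coprime 5 N" "coprime q N" using \<open>\<not> 5 dvd N\<close> \<open>\<not> q dvd N\<close> q(1) by (auto intro!: prime_imp_coprime)
      moreover have "coprime 2 N" using \<open>odd N\<close> by simp
      ultimately show "coprime (int (2 * (5 * q))) (int N)"
        unfolding coprime_int_iff by (simp only: coprime_mult_left_iff)
      show "coprime (int 2) (int (5 * q))" unfolding coprime_int_iff using \<open>odd q\<close> by simp
    qed
    ultimately show "int (2 * (5 * q) * N) dvd ?V"
      by (metis divides_mult of_nat_mult)
  qed
  then obtain x y z :: int where xyz: "z \<noteq> 0" "2 * x\<^sup>2 + 5 * int q * y\<^sup>2 = int N * z\<^sup>2" by auto
  obtain s where "[s\<^sup>2 = -2] (mod int q)" using minus_2 Legendre_eq_1_imp_square by blast
  then obtain Y Z where "int q = Y\<^sup>2 + 2 * Z\<^sup>2"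
    using prime_eq_square_plus_2_square[OF q(1)] \<open>odd q\<close> by blast
  then have "int N * z\<^sup>2 = 2 * x\<^sup>2 + 5 * (Y * y)\<^sup>2 + 10 * (Z * y)\<^sup>2"
    unfolding xyz(2)[symmetric] by (simp add: power2_eq_square algebra_simps)
  then show ?thesis using xyz(1) by blast
qed

text \<open>Removing the square part keeps both residue conditions: it is odd and prime to 5, so its
  square is 1 modulo 8 and 1 or 4 modulo 5. Descent then makes the rational representation
  integral.\<close>

theorem ternary_form_represents:
  fixes N :: nat
  assumes "N mod 8 = 5" "N mod 5 \<in> {2, 3}"
  shows "\<exists>u v t :: int. ternary_form u v t = int N"
proof -
  define k where "k = square_part N"
  define N' where "N' = squarefree_part N"
  have N: "N = N' * k\<^sup>2" unfolding k_def N'_def by (rule squarefree_decompose)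
  have "N' mod 8 = 5"
  proof -
    have "odd k"
    proof
      assume "even k"
      then have "even N" by (simp add: N)
      then show False using assms(1) by presburger
    qed
    then have "k mod 8 \<in> {1, 3, 5, 7}" by (simp; presburger)
    then have "(k mod 8)\<^sup>2 mod 8 = 1" by auto
    then have "k\<^sup>2 mod 8 = 1" by (simp add: power_mod)
    then have "N mod 8 = N' mod 8" unfolding N by (metis mod_mult_right_eq mult.right_neutral)
    then show ?thesis using assms(1) by simp
  qed
  moreover have "N' mod 5 \<in> {2, 3}"
  proof -
    have "k mod 5 \<in> {0, 1, 2, 3, 4}" by (simp; presburger)
    then have "(k mod 5)\<^sup>2 mod 5 \<in> {0, 1, 4}" by auto
    then have "k\<^sup>2 mod 5 \<in> {0, 1, 4}" by (simp add: power_mod)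
    moreover have "N' mod 5 \<in> {0, 1, 2, 3, 4}" by (simp; presburger)
    moreover have "(N' mod 5) * (k\<^sup>2 mod 5) mod 5 \<in> {2, 3}" using assms(2) by (simp add: N mod_mult_eq)
    ultimately show ?thesis by auto
  qed
  ultimately obtain X Y Z T :: int where XYZ: "T \<noteq> 0" "int N' * T\<^sup>2 = 2 * X\<^sup>2 + 5 * Y\<^sup>2 + 10 * Z\<^sup>2"
    using rational_representation_squarefree[of N'] by (auto simp: N'_def)
  define c where "c = int k"
  \<comment> \<open>This substitution diagonalizes the form; the factor \<open>c\<close> restores
    the square part.\<close>
  have "ternary_form (c * (X + Z)) (c * (Y + 2 * Z)) (c * (2 * Z - Y)) = c\<^sup>2 * (2 * X\<^sup>2 + 5 * Y\<^sup>2 + 10 * Z\<^sup>2)"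
    unfolding ternary_form_def by (simp add: power2_eq_square algebra_simps)
  also have "\<dots> = int N * \<bar>T\<bar>\<^sup>2" by (simp add: N c_def flip: XYZ(2))
  finally show ?thesis using ternary_form_integral_of_rational[of "\<bar>T\<bar>"] XYZ(1) by simp
qed

section \<open>Weighted sums of four squares\<close>

text \<open>The sum \<open>u + v + t\<close> agrees with \<open>B\<close> modulo 5 up to sign, and
  the sign may be changed. Dividing \<open>B - (u + v + t)\<close> by 5 gives \<open>w\<close>, and
  the other variables are its translates. A negative variable would contradict the upper bound on
  \<open>A\<close> by Cauchy-Schwarz.\<close>

lemma weighted_four_squares:
  fixes A B N :: int
  assumes form: "ternary_form u v t = N" and N: "5 * A - B\<^sup>2 = 2 * N"
    and B: "0 \<le> B" "4 * A < B\<^sup>2 + 2 * B + 5"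
  shows "\<exists>w x y z. 0 \<le> w \<and> 0 \<le> x \<and> 0 \<le> y \<and> 0 \<le> z
    \<and> 2 * w + x + y + z = B \<and> 2 * w\<^sup>2 + x\<^sup>2 + y\<^sup>2 + z\<^sup>2 = A"
proof -
  have form_sum: "2 * ternary_form u v t = 5 * (u\<^sup>2 + v\<^sup>2 + t\<^sup>2) - (u + v + t)\<^sup>2" for u v t :: int
    unfolding ternary_form_def by (simp add: power2_eq_square algebra_simps)
  have "(B - (u + v + t)) * (B + (u + v + t)) = 5 * (A - (u\<^sup>2 + v\<^sup>2 + t\<^sup>2))"
    using form_sum[of u v t] N form by (simp add: power2_eq_square algebra_simps)
  then have "5 dvd (B - (u + v + t)) * (B + (u + v + t))" by simp
  moreover have "prime (5::int)" by simp
  ultimately have "5 dvd B - (u + v + t) \<or> 5 dvd B + (u + v + t)"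
    using prime_dvd_mult_iff by blast
  moreover have "B + (u + v + t) = B - (- u + - v + - t)" by simp
  moreover have "ternary_form (- u) (- v) (- t) = N" using form by (simp add: ternary_form_def)
  ultimately obtain u v t where uvt: "ternary_form u v t = N" "5 dvd B - (u + v + t)"
    using form by metis
  then obtain w where w: "B = 5 * w + (u + v + t)" by (metis dvd_def diff_eq_eq)
  define x y z where "x = w + u" and "y = w + v" and "z = w + t"
  have sum1: "2 * w + x + y + z = B" by (simp add: x_def y_def z_def w)
  have "5 * (2 * w\<^sup>2 + x\<^sup>2 + y\<^sup>2 + z\<^sup>2) = B\<^sup>2 + (5 * (u\<^sup>2 + v\<^sup>2 + t\<^sup>2) - (u + v + t)\<^sup>2)"
    by (simp add: x_def y_def z_def w power2_eq_square algebra_simps)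
  also have "\<dots> = 5 * A" using form_sum[of u v t] uvt(1) N by simp
  finally have sum2: "2 * w\<^sup>2 + x\<^sup>2 + y\<^sup>2 + z\<^sup>2 = A" by simp
  have nonneg: "0 \<le> p" if p: "2 * w + p + q + r = B" "2 * w\<^sup>2 + p\<^sup>2 + q\<^sup>2 + r\<^sup>2 = A" for p q r
  proof (rule ccontr)
    assume "\<not> 0 \<le> p"
    then have "p \<le> -1" by simp
    \<comment> \<open>Cauchy-Schwarz with total weight 4; together with \<open>p <= -1\<close> it
      forces \<open>4 * A >= B^2 + 2 * B + 5\<close>.\<close>
    have "4 * (2 * w\<^sup>2 + q\<^sup>2 + r\<^sup>2) - (2 * w + q + r)\<^sup>2 = 2 * (w - q)\<^sup>2 + 2 * (w - r)\<^sup>2 + (q - r)\<^sup>2"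
      by (simp add: power2_eq_square algebra_simps)
    moreover have "0 \<le> 2 * (w - q)\<^sup>2 + 2 * (w - r)\<^sup>2 + (q - r)\<^sup>2" by simp
    ultimately have "(2 * w + q + r)\<^sup>2 \<le> 4 * (2 * w\<^sup>2 + q\<^sup>2 + r\<^sup>2)" by linarith
    moreover have "2 * w + q + r = B - p" "2 * w\<^sup>2 + q\<^sup>2 + r\<^sup>2 = A - p\<^sup>2" using p by simp_all
    ultimately have "(B - p)\<^sup>2 \<le> 4 * (A - p\<^sup>2)" by (simp only:)
    then have "B\<^sup>2 - 2 * (B * p) + 5 * p\<^sup>2 \<le> 4 * A" by (simp add: power2_eq_square algebra_simps)
    moreover have "B * p \<le> B * (-1)" using B(1) \<open>p \<le> -1\<close> by (rule mult_left_mono[rotated])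
    moreover have "1 \<le> p\<^sup>2" using \<open>p \<le> -1\<close> by (simp add: power2_ge_1_iff abs_if)
    ultimately show False using B(2) by linarith
  qed
  have "0 \<le> w"
  proof (rule ccontr)
    assume "\<not> 0 \<le> w"
    then have "w \<le> -1" by simp
    \<comment> \<open>A negative \<open>w\<close> leaves total weight 3 and forces
      \<open>3 * A >= B^2 + 4 * B + 10\<close>, which is also too large.\<close>
    have "3 * (x\<^sup>2 + y\<^sup>2 + z\<^sup>2) - (x + y + z)\<^sup>2 = (x - y)\<^sup>2 + (y - z)\<^sup>2 + (z - x)\<^sup>2"
      by (simp add: power2_eq_square algebra_simps)
    moreover have "0 \<le> (x - y)\<^sup>2 + (y - z)\<^sup>2 + (z - x)\<^sup>2" by simp
    ultimately have "(x + y + z)\<^sup>2 \<le> 3 * (x\<^sup>2 + y\<^sup>2 + z\<^sup>2)" by linarith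
    moreover have "x + y + z = B - 2 * w" "x\<^sup>2 + y\<^sup>2 + z\<^sup>2 = A - 2 * w\<^sup>2" using sum1 sum2 by simp_all
    ultimately have "(B - 2 * w)\<^sup>2 \<le> 3 * (A - 2 * w\<^sup>2)" by (simp only:)
    then have "B\<^sup>2 - 4 * (B * w) + 10 * w\<^sup>2 \<le> 3 * A" by (simp add: power2_eq_square algebra_simps)
    moreover have "B * w \<le> B * (-1)" using B(1) \<open>w \<le> -1\<close> by (rule mult_left_mono[rotated])
    moreover have "1 \<le> w\<^sup>2" using \<open>w \<le> -1\<close> by (simp add: power2_ge_1_iff abs_if)
    moreover have "0 \<le> A" unfolding sum2[symmetric] by simp
    ultimately show False using B by linarith
  qed
  moreover have "0 \<le> x" "0 \<le> y" "0 \<le> z"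
    using nonneg[of x y z] nonneg[of y x z] nonneg[of z x y] sum1 sum2 by (simp_all add: ac_simps)
  ultimately show ?thesis using sum1 sum2 by blast
qed

section \<open>The choice of the linear sum: congruences and size\<close>

text \<open>Restricting to even \<open>j = 2 i\<close> makes the quadratic polynomial a permutation modulo 8 in \<open>i\<close>.\<close>

lemma odd_quadratic_attains_mod_16:
  fixes c d e :: int
  assumes "odd c" "even d"
  shows "\<exists>j\<in>{0..<16}. (d - (c * j + e * j\<^sup>2)) mod 16 = 10"
proof -
  define f where "f i = (c * i + 2 * e * i\<^sup>2) mod 8" for i
  have "inj_on f {0..<8}"
  proof (rule inj_onI)
    fix i k assume ik: "i \<in> {0..<8}" "k \<in> {0..<8}" "f i = f k"
    then have "8 dvd (c * i + 2 * e * i\<^sup>2) - (c * k + 2 * e * k\<^sup>2)" by (simp add: f_def mod_eq_dvd_iff)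
    also have "\<dots> = (i - k) * (c + 2 * e * (i + k))" by (simp add: power2_eq_square algebra_simps)
    finally have "8 dvd (i - k) * (c + 2 * e * (i + k))" .
    moreover have "coprime (2 ^ 3) (c + 2 * e * (i + k))"
      unfolding coprime_power_left_iff using assms(1) by simp
    ultimately have "8 dvd i - k" by (simp add: coprime_dvd_mult_left_iff)
    then have "i mod 8 = k mod 8" by (simp add: mod_eq_dvd_iff)
    then show "i = k" using ik by simp
  qed
  moreover have "f ` {0..<8} \<subseteq> {0..<8}" by (auto simp: f_def)
  ultimately have surj: "f ` {0..<8} = {0..<8}" by (intro endo_inj_surj) auto
  have "even (d - 10)" using assms(2) by simp
  then obtain m where m: "d - 10 = 2 * m" by (elim evenE)
  have "m mod 8 \<in> f ` {0..<8}" unfolding surj by simp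
  then obtain i where i: "i \<in> {0..<8}" "f i = m mod 8" by (metis imageE)
  then have "8 dvd m - (c * i + 2 * e * i\<^sup>2)" unfolding f_def using mod_eq_dvd_iff by metis
  then obtain l where "m - (c * i + 2 * e * i\<^sup>2) = 8 * l" by blast
  then have "d - (c * (2 * i) + e * (2 * i)\<^sup>2) = 10 + l * 16"
    using m by (simp add: power2_eq_square algebra_simps)
  then have "(d - (c * (2 * i) + e * (2 * i)\<^sup>2)) mod 16 = (10 + l * 16) mod 16" by (simp only:)
  also have "\<dots> = 10" by simp
  finally have "(d - (c * (2 * i) + e * (2 * i)\<^sup>2)) mod 16 = 10" .
  then show ?thesis using i(1) by (intro bexI[of _ "2 * i"]) auto
qed

text \<open>With \<open>a * A = 2 * n - b * B\<close> the inequalities say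
  \<open>4 * A <= B^2 + 2 * B\<close> and \<open>B^2 <= 5 * A\<close>. The left endpoint
  \<open>\<beta>\<close> is the larger root of the first quadratic; the lower bound on
  \<open>n\<close> pushes it far enough right for the second inequality to hold at
  \<open>\<beta> + 32 * a\<close>.\<close>

lemma admissible_interval:
  fixes a b n :: real
  assumes a: "1 \<le> a" and b: "- a < b"
    and n: "n \<ge> 275 * a * (60 * a\<^sup>2 + b) + 25 / 2 * (120 * a\<^sup>2 + b) * sqrt (2 * (60 * a\<^sup>2 + b))"
  shows "\<exists>\<beta>\<ge>0. \<forall>B. \<beta> \<le> B \<longrightarrow> B \<le> \<beta> + 32 * a \<longrightarrow>
    8 * n \<le> a * B\<^sup>2 + (2 * a + 4 * b) * B \<and> a * B\<^sup>2 + 5 * b * B \<le> 10 * n"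
proof -
  define s where "s = sqrt (2 * (60 * a\<^sup>2 + b))"
  have "a \<le> a\<^sup>2" using a by (simp add: power2_eq_square)
  then have "0 \<le> 60 * a\<^sup>2 + b" using a b by linarith
  then have s: "0 \<le> s" "s\<^sup>2 = 120 * a\<^sup>2 + 2 * b" by (simp_all add: s_def algebra_simps)
  \<comment> \<open>An explicit lower bound for \<open>\<beta>\<close>. In the proof of
    \<open>U\<close> the shift \<open>128 * a\<close> completes the square of
    \<open>\<beta>^2 - 256 * a * \<beta>\<close>, and 18 is the least integer whose doubled square
    is at least 640, so that \<open>(18 * s)^2\<close> absorbs the term
    \<open>640 * b\<close>.\<close>
  define \<beta>\<^sub>0 where "\<beta>\<^sub>0 = 128 * a + 18 * s"
  have \<beta>\<^sub>0: "a * \<beta>\<^sub>0\<^sup>2 + (2 * a + 4 * b) * \<beta>\<^sub>0 \<le> 8 * n"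
  proof -
    have n': "275 * a * (60 * a\<^sup>2 + b) + 25 / 2 * (120 * a\<^sup>2 + b) * s \<le> n"
      unfolding s_def using n .
    \<comment> \<open>Eliminating \<open>b\<close> in favour of \<open>s\<close> makes both sides
      polynomials in \<open>a\<close> and \<open>s\<close> that can be compared term by
      term.\<close>
    have b_eq: "b = s\<^sup>2 / 2 - 60 * a\<^sup>2" using s(2) by linarith
    have "8 * n \<ge> 1100 * (a * s\<^sup>2) + 6000 * (a\<^sup>2 * s) + 50 * s ^ 3"
      using n' unfolding b_eq by (simp add: power2_eq_square power3_eq_cube algebra_simps)
    moreover have "a * \<beta>\<^sub>0\<^sup>2 + (2 * a + 4 * b) * \<beta>\<^sub>0
        = - 14336 * a ^ 3 + 288 * (a\<^sup>2 * s) + 580 * (a * s\<^sup>2) + 36 * s ^ 3 + 256 * a\<^sup>2 + 36 * (a * s)"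
      unfolding b_eq \<beta>\<^sub>0_def by (simp add: power2_eq_square power3_eq_cube algebra_simps)
    moreover have "a\<^sup>2 \<le> a ^ 3" using a by (intro power_increasing) auto
    moreover have "a * s \<le> a\<^sup>2 * s" using s(1) \<open>a \<le> a\<^sup>2\<close> by (rule mult_right_mono[rotated])
    moreover have "0 \<le> a ^ 3" "0 \<le> a\<^sup>2 * s" "0 \<le> a * s\<^sup>2" "0 \<le> s ^ 3" using a s(1) by auto
    ultimately show ?thesis by linarith
  qed
  define \<Delta> where "\<Delta> = (a + 2 * b)\<^sup>2 + 8 * a * n"
  define \<beta> where "\<beta> = (sqrt \<Delta> - (a + 2 * b)) / a"
  have "(a * \<beta>\<^sub>0 + (a + 2 * b))\<^sup>2 = (a + 2 * b)\<^sup>2 + a * (a * \<beta>\<^sub>0\<^sup>2 + (2 * a + 4 * b) * \<beta>\<^sub>0)"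
    by (simp add: power2_eq_square algebra_simps)
  also have "\<dots> \<le> (a + 2 * b)\<^sup>2 + a * (8 * n)" using a \<beta>\<^sub>0 by (intro add_left_mono mult_left_mono) auto
  finally have le: "(a * \<beta>\<^sub>0 + (a + 2 * b))\<^sup>2 \<le> \<Delta>" by (simp add: \<Delta>_def)
  then have "a * \<beta>\<^sub>0 + (a + 2 * b) \<le> sqrt \<Delta>" by (rule real_le_rsqrt)
  then have "\<beta>\<^sub>0 \<le> \<beta>" using a by (simp add: \<beta>_def field_simps)
  then have \<beta>_ge: "128 * a + 18 * s \<le> \<beta>" by (simp add: \<beta>\<^sub>0_def)
  have "0 \<le> \<Delta>" using le zero_le_power2 by (rule order_trans[rotated])
  then have "(a * \<beta> + (a + 2 * b))\<^sup>2 = \<Delta>" using a by (simp add: \<beta>_def)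
  then have "a * (a * \<beta>\<^sup>2 + (2 * a + 4 * b) * \<beta>) = a * (8 * n)"
    by (simp add: \<Delta>_def power2_eq_square algebra_simps)
  then have P: "a * \<beta>\<^sup>2 + (2 * a + 4 * b) * \<beta> = 8 * n" using a by simp
  have U: "a * (\<beta> + 32 * a)\<^sup>2 + 5 * b * (\<beta> + 32 * a) \<le> 10 * n"
  proof -
    have "(18 * s)\<^sup>2 \<le> (\<beta> - 128 * a)\<^sup>2" using \<beta>_ge s(1) by (intro power_mono) auto
    then have "38880 * a\<^sup>2 + 648 * b \<le> \<beta>\<^sup>2 - 256 * (a * \<beta>) + 16384 * a\<^sup>2"
      using s(2) by (simp add: power2_eq_square algebra_simps)
    moreover have "0 \<le> \<beta>" using \<beta>_ge s(1) a by linarith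
    ultimately have "0 \<le> \<beta>\<^sup>2 + 10 * \<beta> - 256 * (a * \<beta>) - 4096 * a\<^sup>2 - 640 * b"
      using \<open>a \<le> a\<^sup>2\<close> a b by linarith
    then have "0 \<le> a * (\<beta>\<^sup>2 + 10 * \<beta> - 256 * (a * \<beta>) - 4096 * a\<^sup>2 - 640 * b)" using a by simp
    also have "\<dots> = 5 * (a * \<beta>\<^sup>2 + (2 * a + 4 * b) * \<beta>) - 4 * (a * (\<beta> + 32 * a)\<^sup>2 + 5 * b * (\<beta> + 32 * a))"
      by (simp add: power2_eq_square algebra_simps)
    finally show ?thesis unfolding P by simp
  qed
  have "3 \<le> \<beta>" using \<beta>_ge s(1) a by linarith
  have a\<beta>: "3 * a \<le> a * \<beta>" using mult_left_mono[OF \<open>3 \<le> \<beta>\<close>, of a] a by simp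
  show ?thesis
  proof (intro exI[of _ \<beta>] conjI allI impI)
    show "0 \<le> \<beta>" using \<open>3 \<le> \<beta>\<close> by simp
    fix B assume B: "\<beta> \<le> B" "B \<le> \<beta> + 32 * a"
    have aB: "a * \<beta> \<le> a * B" using B(1) a by (intro mult_left_mono) auto
    have "0 \<le> (B - \<beta>) * (a * B + a * \<beta> + (2 * a + 4 * b))"
      using B(1) aB a\<beta> a b by (intro mult_nonneg_nonneg) linarith+
    also have "\<dots> = (a * B\<^sup>2 + (2 * a + 4 * b) * B) - (a * \<beta>\<^sup>2 + (2 * a + 4 * b) * \<beta>)"
      by (simp add: power2_eq_square algebra_simps)
    finally show "8 * n \<le> a * B\<^sup>2 + (2 * a + 4 * b) * B" using P by simp
    have "a * \<beta> \<le> a * (\<beta> + 32 * a)" using a by (intro mult_left_mono) auto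
    then have "0 \<le> (\<beta> + 32 * a - B) * (a * (\<beta> + 32 * a) + a * B + 5 * b)"
      using B(2) aB a\<beta> a b by (intro mult_nonneg_nonneg) linarith+
    also have "\<dots> = (a * (\<beta> + 32 * a)\<^sup>2 + 5 * b * (\<beta> + 32 * a)) - (a * B\<^sup>2 + 5 * b * B)"
      by (simp add: power2_eq_square algebra_simps)
    finally show "a * B\<^sup>2 + 5 * b * B \<le> 10 * n" using U by simp
  qed
qed

theorem corollary6:
  fixes a b n :: int
  assumes "a > 0" and "b > - a" and "odd (a * b)" and "gcd a (5 * b) = 1"
    and "real_of_int n \<ge> 275 * real_of_int a * (60 * (real_of_int a)\<^sup>2 + real_of_int b)
           + 25 / 2 * (120 * (real_of_int a)\<^sup>2 + real_of_int b)
             * sqrt (2 * (60 * (real_of_int a)\<^sup>2 + real_of_int b))"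
  shows "\<exists>w x y z :: nat.
           real_of_int n =
             real w * (real_of_int a * real w + real_of_int b)
             + real x * (real_of_int a * real x + real_of_int b) / 2
             + real y * (real_of_int a * real y + real_of_int b) / 2
             + real z * (real_of_int a * real z + real_of_int b) / 2"
proof -
  have odd: "odd a" "odd b" using assms(3) by simp_all
  have "coprime a (5 * b)" using assms(4) by (simp add: coprime_iff_gcd_eq_1)
  then have cop: "coprime b a" "coprime 5 a" by (simp_all add: coprime_commute)
  have "\<not> 5 dvd a" using coprime_common_divisor[OF cop(2), of 5] by auto
  obtain \<beta> where \<beta>: "\<And>B. \<beta> \<le> B \<Longrightarrow> B \<le> \<beta> + 32 * real_of_int a \<Longrightarrow>
      8 * real_of_int n \<le> a * B\<^sup>2 + (2 * real_of_int a + 4 * b) * B \<and> a * B\<^sup>2 + 5 * real_of_int b * B \<le> 10 * n"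
    "\<beta> \<ge> 0"
    using admissible_interval[OF _ _ assms(5)] assms(1,2) by force
  obtain r where "[b * r = 1] (mod a)" using cong_solve_coprime_int[OF cop(1)] by blast
  then have r: "a dvd b * r - 1" by (simp add: cong_iff_dvd_diff)
  \<comment> \<open>The least integer from \<open>\<beta>\<close> upwards in the class of
    \<open>2 * n * r\<close> modulo \<open>a\<close>, where \<open>r\<close> inverts
    \<open>b\<close>; this makes \<open>2 * n - b * s\<close> divisible by \<open>a\<close>.\<close>
  define s where "s = \<lceil>\<beta>\<rceil> + (2 * n * r - \<lceil>\<beta>\<rceil>) mod a"
  have s: "\<beta> \<le> s" "s \<le> \<beta> + a"
  proof -
    have "0 \<le> (2 * n * r - \<lceil>\<beta>\<rceil>) mod a" "(2 * n * r - \<lceil>\<beta>\<rceil>) mod a \<le> a - 1"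
      using assms(1) pos_mod_bound[of a] by (auto simp: zle_diff1_eq)
    then have "\<lceil>\<beta>\<rceil> \<le> s" "s \<le> \<lceil>\<beta>\<rceil> + a - 1" unfolding s_def by linarith+
    then show "\<beta> \<le> s" "s \<le> \<beta> + a" by linarith+
  qed
  have "a dvd 2 * n - b * s"
  proof -
    have "s mod a = 2 * n * r mod a" by (simp add: s_def mod_add_right_eq)
    then have "a dvd s - 2 * n * r" by (simp add: mod_eq_dvd_iff)
    then have "a dvd 2 * n * (b * r - 1) + b * (s - 2 * n * r)"
      using r by (metis dvd_add dvd_mult)
    then have "a dvd - (2 * n * (b * r - 1) + b * (s - 2 * n * r))" by (simp only: dvd_minus_iff)
    then show ?thesis by (simp add: algebra_simps)
  qed
  then obtain A0 where "2 * n - b * s = a * A0" by blast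
  then have A0: "2 * n = a * A0 + b * s" by simp
  have "even (a * A0 + b * s)" unfolding A0[symmetric] by simp
  \<comment> \<open>As \<open>a\<close> and \<open>b\<close> are odd, \<open>A0\<close> and
    \<open>s\<close> have the same parity.\<close>
  then have even: "even (5 * A0 - s\<^sup>2)" using odd by simp
  define c where "c = 5 * b + 2 * (s * a)"
  have "odd c" using odd by (simp add: c_def)
  have disc: "5 * (A0 - b * j) - (s + a * j)\<^sup>2 = 5 * A0 - s\<^sup>2 - (c * j + a\<^sup>2 * j\<^sup>2)" for j
    by (simp add: c_def power2_eq_square algebra_simps)
  \<comment> \<open>Replacing \<open>s\<close> by \<open>s + a * j\<close> replaces
    \<open>A0\<close> by \<open>A0 - b * j\<close>. The residue 10 modulo 16 of
    \<open>5 * A - B^2 = 2 * N\<close> means that \<open>N\<close> is 5 modulo 8.\<close>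
  obtain j where j: "j \<in> {0..<16}" "(5 * (A0 - b * j) - (s + a * j)\<^sup>2) mod 16 = 10"
    unfolding disc using odd_quadratic_attains_mod_16[OF \<open>odd c\<close> even] by blast
  \<comment> \<open>If 5 divides the candidate for \<open>B\<close>, a further shift of
    \<open>j\<close> by 16 keeps the residue modulo 16 and changes the one modulo 5; hence 32
    candidates suffice.\<close>
  obtain i where i: "0 \<le> i" "i \<le> 31" "(5 * (A0 - b * i) - (s + a * i)\<^sup>2) mod 16 = 10" "\<not> 5 dvd s + a * i"
  proof (cases "5 dvd s + a * j")
    case False
    then show ?thesis using that[of j] j by simp
  next
    case True
    have "5 * (A0 - b * (j + 16)) - (s + a * (j + 16))\<^sup>2
        = 5 * (A0 - b * j) - (s + a * j)\<^sup>2 + (- 5 * b - 2 * a * (s + a * j) - 16 * a\<^sup>2) * 16"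
      by (simp add: power2_eq_square algebra_simps)
    then have "(5 * (A0 - b * (j + 16)) - (s + a * (j + 16))\<^sup>2) mod 16 = 10"
      using j(2) by (simp only: mod_mult_self1)
    moreover have "\<not> 5 dvd s + a * (j + 16)"
    proof
      assume "5 dvd s + a * (j + 16)"
      then have "5 dvd (s + a * (j + 16)) - (s + a * j)" using True by (rule dvd_diff)
      then have "5 dvd 16 * a" by (simp add: algebra_simps)
      then show False using \<open>\<not> 5 dvd a\<close> by presburger
    qed
    ultimately show ?thesis using that[of "j + 16"] j(1) by simp
  qed
  define A B where "A = A0 - b * i" and "B = s + a * i"
  have n: "2 * n = a * A + b * B" unfolding A0 A_def B_def by (simp add: algebra_simps)
  have "a * i \<le> a * 31" "0 \<le> a * i" using i(1,2) assms(1) by simp_all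
  then have "\<beta> \<le> B" "real_of_int B \<le> \<beta> + 32 * real_of_int a" using s unfolding B_def by linarith+
  from \<beta>(1)[OF this]
  have "real_of_int (8 * n) \<le> real_of_int (a * B\<^sup>2 + (2 * a + 4 * b) * B)"
    "real_of_int (a * B\<^sup>2 + 5 * b * B) \<le> real_of_int (10 * n)" by simp_all
  then have bounds: "8 * n \<le> a * B\<^sup>2 + (2 * a + 4 * b) * B" "a * B\<^sup>2 + 5 * b * B \<le> 10 * n"
    by (simp_all only: of_int_le_iff)
  have "0 \<le> B" using \<open>\<beta> \<le> B\<close> \<beta>(2) by linarith
  have "a * (4 * A) \<le> a * (B\<^sup>2 + 2 * B)"
  proof -
    have "8 * n = 4 * (a * A + b * B)" using n by simp
    then show ?thesis using bounds(1) by (simp add: algebra_simps)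
  qed
  then have "4 * A < B\<^sup>2 + 2 * B + 5" using assms(1) by simp
  have "a * B\<^sup>2 \<le> a * (5 * A)"
  proof -
    have "10 * n = 5 * (a * A + b * B)" using n by simp
    then show ?thesis using bounds(2) by (simp add: algebra_simps)
  qed
  then have "0 \<le> 5 * A - B\<^sup>2" using assms(1) by simp
  define N where "N = nat ((5 * A - B\<^sup>2) div 2)"
  have mod16: "(5 * A - B\<^sup>2) mod 16 = 10" using i(3) by (simp add: A_def B_def)
  then have "even (5 * A - B\<^sup>2)" by presburger
  then have N: "5 * A - B\<^sup>2 = 2 * int N" using \<open>0 \<le> 5 * A - B\<^sup>2\<close> by (simp add: N_def)
  have "N mod 8 = 5" using mod16 unfolding N by presburger
  moreover have "N mod 5 \<in> {2, 3}"
  proof -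
    have "B mod 5 \<in> {1, 2, 3, 4}" using i(4) unfolding B_def[symmetric] by (simp; presburger)
    then have "(B mod 5)\<^sup>2 mod 5 \<in> {1, 4}" by auto
    then have "B\<^sup>2 mod 5 = 1 \<or> B\<^sup>2 mod 5 = 4" by (simp add: power_mod)
    \<comment> \<open>Modulo 5, \<open>2 * N\<close> is \<open>- B^2\<close>, which is 4 or
      1.\<close>
    then have "N mod 5 = 2 \<or> N mod 5 = 3" using N by presburger
    then show ?thesis by simp
  qed
  ultimately obtain u v t where "ternary_form u v t = int N" using ternary_form_represents by blast
  from weighted_four_squares[OF this N \<open>0 \<le> B\<close> \<open>4 * A < B\<^sup>2 + 2 * B + 5\<close>]
  obtain w x y z where wxyz: "0 \<le> w" "0 \<le> x" "0 \<le> y" "0 \<le> z" "2 * w + x + y + z = B"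
    "2 * w\<^sup>2 + x\<^sup>2 + y\<^sup>2 + z\<^sup>2 = A" by blast
  have "2 * n = 2 * (w * (a * w + b)) + x * (a * x + b) + y * (a * y + b) + z * (a * z + b)"
    unfolding n wxyz(5,6)[symmetric] by (simp add: power2_eq_square algebra_simps)
  then have "2 * real_of_int n = real_of_int
      (2 * (w * (a * w + b)) + x * (a * x + b) + y * (a * y + b) + z * (a * z + b))"
    by (metis of_int_mult of_int_numeral)
  then have "real_of_int n = real (nat w) * (real_of_int a * real (nat w) + real_of_int b)
      + real (nat x) * (real_of_int a * real (nat x) + real_of_int b) / 2
      + real (nat y) * (real_of_int a * real (nat y) + real_of_int b) / 2
      + real (nat z) * (real_of_int a * real (nat z) + real_of_int b) / 2"
    using wxyz(1-4) by simp
  then show ?thesis by blast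
qed

end
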